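(* Let $\mathbb D\in\mathbb R^{p\times p}$ be a symmetric positive definite matrix with $\alpha(\mathbb D)=1$, and suppose $$\nabla^2 f(\theta)\succeq \nabla^2 f(\hat\theta)-\mathbb D^2=\mathbb D_G^2-\mathbb D^2\qquad\text{for all }\theta\in\mathbb R^p .$$ Let $r\ge 3+3\sqrt{\mathtt p(\mathbb D)}$ be such that $\omega(\mathcal U(\mathbb D,r),\mathbb D)\le 1/3$. Then $$\pi_f\big(\mathcal U(\mathbb D,r)^c\big)\le \frac13\exp\Big(-\big(r-3\sqrt{\mathtt p(\mathbb D)}\big)^2/3\Big).$$
   Context: Let $p\ge1$ and let $f:\mathbb R^p\to\mathbb R$ be at least three times differentiable with $\int e^{-f}<\infty$ and with a unique global minimizer $\hat\theta$. Let $\pi_f(\theta)\propto e^{-f(\theta)}$ be the associated probability density (and probability measure) on $\mathbb R^p$. Let $\mathbb D_G\succ0$ be the symmetric positive definite matrix with $\mathbb D_G^2=\nabla^2 f(\hat\theta)$ (assumed positive definite). $\|\cdot\|$ is the Euclidean norm of vectors and the operator norm of matrices. For symmetric $\mathbb D\succ0$ define $\alpha(\mathbb D)=\|\mathbb D_G^{-1}\mathbb D\|$, $\mathtt p(\mathbb D)=\mathrm{Tr}(\mathbb D_G^{-2}\mathbb D^2)/\|\mathbb D_G^{-1}\mathbb D\|^2$ ("effective dimension"), $\mathcal U(\mathbb D,r)=\{\theta\in\mathbb R^p:\|\mathbb D(\theta-\hat\theta)\|\le r\}$, and for a set $\mathcal U\ni\hat\theta$, $$\omega(\mathcal U,\mathbb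 D)=\sup_{\theta\in\mathcal U,\ \theta\neq\hat\theta}\frac{\big|f(\theta)-f(\hat\theta)-\|\mathbb D_G(\theta-\hat\theta)\|^2/2\big|}{\|\mathbb D(\theta-\hat\theta)\|^2/2}.$$ *)

theory Defs
  imports "HOL-Analysis.Analysis"
begin

definition thrice_differentiable ::
  "('a::real_normed_vector \<Rightarrow> 'b::real_normed_vector) \<Rightarrow> bool" where
  "thrice_differentiable f \<longleftrightarrow>
     (\<exists>(f1 :: 'a \<Rightarrow> ('a \<Rightarrow>\<^sub>L 'b)) (f2 :: 'a \<Rightarrow> ('a \<Rightarrow>\<^sub>L ('a \<Rightarrow>\<^sub>L 'b))).
        (\<forall>x. (f has_derivative blinfun_apply (f1 x)) (at x)) \<and>
        (\<forall>x. (f1 has_derivative blinfun_apply (f2 x)) (at x)) \<and>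
        (\<forall>x. f2 differentiable (at x)))"

definition hessian :: "(real^'p \<Rightarrow> real) \<Rightarrow> real^'p \<Rightarrow> real^'p^'p" where
  "hessian f x =
     (\<chi> i j. frechet_derivative
               (\<lambda>y. frechet_derivative f (at y) (axis j 1)) (at x) (axis i 1))"

definition sym_pos_def :: "real^'p^'p \<Rightarrow> bool" where
  "sym_pos_def A \<longleftrightarrow> transpose A = A \<and> (\<forall>v. v \<noteq> 0 \<longrightarrow> 0 < v \<bullet> (A *v v))"

text \<open>The order of symmetric matrices: the difference is symmetric positive semidefinite.\<close>

definition loewner_le :: "real^'p^'p \<Rightarrow> real^'p^'p \<Rightarrow> bool" (infix "\<preceq>" 50) where
  "A \<preceq> B \<longleftrightarrow> transpose (B - A) = B - A \<and> (\<forall>v. 0 \<le> v \<bullet> ((B - A) *v v))"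

definition unique_global_minimizer :: "('a \<Rightarrow> real) \<Rightarrow> 'a \<Rightarrow> bool" where
  "unique_global_minimizer f x \<longleftrightarrow> (\<forall>y. y \<noteq> x \<longrightarrow> f x < f y)"

definition gibbs_measure :: "(real^'p \<Rightarrow> real) \<Rightarrow> (real^'p) measure" where
  "gibbs_measure f =
     density lborel (\<lambda>x. ennreal (exp (- f x) / (\<integral>y. exp (- f y) \<partial>lborel)))"

definition op_norm :: "real^'p^'p \<Rightarrow> real" where
  "op_norm A = onorm (\<lambda>v. A *v v)"

text \<open>In the next four definitions \<open>G\<close> is the square root of the Hessian of \<open>f\<close> at its
  minimizer, and \<open>x0\<close> is that minimizer.\<close>

definition alpha :: "real^'p^'p \<Rightarrow> real^'p^'p \<Rightarrow> real" where
  "alpha G D = op_norm (matrix_inv G ** D)"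

definition eff_dim :: "real^'p^'p \<Rightarrow> real^'p^'p \<Rightarrow> real" where
  "eff_dim G D =
     trace ((matrix_inv G ** matrix_inv G) ** (D ** D)) / (op_norm (matrix_inv G ** D))\<^sup>2"

definition local_set :: "real^'p \<Rightarrow> real^'p^'p \<Rightarrow> real \<Rightarrow> (real^'p) set" where
  "local_set x0 D r = {x. norm (D *v (x - x0)) \<le> r}"

text \<open>The supremum is taken in the extended reals, since it may be infinite.\<close>

definition omega ::
  "(real^'p \<Rightarrow> real) \<Rightarrow> real^'p \<Rightarrow> real^'p^'p \<Rightarrow> (real^'p) set \<Rightarrow> real^'p^'p \<Rightarrow> ereal" where
  "omega f x0 G U D =
     (SUP x\<in>U - {x0}. ereal (\<bar>f x - f x0 - (norm (G *v (x - x0)))\<^sup>2 / 2\<bar>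
                              / ((norm (D *v (x - x0)))\<^sup>2 / 2)))"

end

theory Submission
  imports Defs "HOL-Probability.Distributions" "HOL-Real_Asymp.Real_Asymp"
begin

text \<open>Write \<open>u = \<theta> - \<theta>0\<close>, \<open>X = |D u|\<close> and \<open>s\<^sup>2 = eff_dim\<close>. Inside the local set the bound on
  \<open>\<omega>\<close> gives \<open>f \<theta> - f \<theta>0 \<le> |G u|\<^sup>2 / 2 + X\<^sup>2 / 6\<close>. The Hessian condition says that
  \<open>f + X\<^sup>2 / 2 - |G u|\<^sup>2 / 2\<close> is convex, which carries the lower bound \<open>r\<^sup>2 / 3\<close> of this function
  (minus \<open>f \<theta>0\<close>) on the boundary outwards: outside,
  \<open>f \<theta> - f \<theta>0 \<ge> |G u|\<^sup>2 / 2 - X\<^sup>2 / 2 + r X / 3\<close>. In coordinates \<open>v\<close> diagonalising \<open>G\<^sup>2\<close> and \<open>D\<^sup>2\<close>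
  simultaneously, \<open>|G u| = |v|\<close> and \<open>X\<^sup>2 = \<Sum> l\<^sub>b v\<^sub>b\<^sup>2\<close> with \<open>0 \<le> l\<^sub>b \<le> 1\<close> and \<open>\<Sum> l\<^sub>b = s\<^sup>2 \<ge> 1\<close>, so for a
  standard Gaussian \<open>v\<close> a Chernoff bound gives \<open>P(X \<ge> x) \<le> exp (- (x - s)\<^sup>2 / 2)\<close>. Integrating this
  tail against \<open>exp (X\<^sup>2 / 2 - r X / 3)\<close> bounds the mass outside, and
  \<open>E (exp (- X\<^sup>2 / 6)) \<ge> exp (- s\<^sup>2 / 6)\<close>, less the tail, bounds the mass inside.\<close>

section \<open>Eigenbases of self-adjoint maps\<close>

text \<open>Rayleigh's principle on the orthogonal complement \<open>S\<close> of \<open>B\<close>: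
  since \<open>B\<close> consists of eigenvectors, self-adjointness makes \<open>S\<close> invariant
  under \<open>f\<close>, and a maximiser of \<open>x \<bullet> f x\<close> on the unit sphere of
  \<open>S\<close> is an eigenvector.\<close>

lemma selfadjoint_eigenvector_orthogonal:
  fixes f :: "'a::euclidean_space \<Rightarrow> 'a"
  assumes lin: "linear f" and sa: "\<And>x y. f x \<bullet> y = x \<bullet> f y"
    and eig: "\<And>b. b \<in> B \<Longrightarrow> \<exists>c. f b = c *\<^sub>R b" and dim: "dim B < DIM('a)"
  obtains v l where "norm v = 1" "f v = l *\<^sub>R v" "\<And>b. b \<in> B \<Longrightarrow> v \<bullet> b = 0"
proof -
  define S where "S = {x. \<forall>b\<in>B. x \<bullet> b = 0}"
  obtain z where z: "z \<noteq> 0" "\<And>y. y \<in> span B \<Longrightarrow> orthogonal z y"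
    using orthogonal_to_subspace_exists[OF dim] by blast
  have S_lin: "x + t *\<^sub>R y \<in> S" "t *\<^sub>R x \<in> S" if "x \<in> S" "y \<in> S" for x y t
    using that by (auto simp: S_def inner_add_left)
  have f_S: "f x \<in> S" if "x \<in> S" for x
    unfolding S_def
  proof safe
    fix b assume b: "b \<in> B"
    then obtain c where "f b = c *\<^sub>R b" using eig by blast
    then show "f x \<bullet> b = 0" using that b by (simp add: sa S_def)
  qed
  define K where "K = S \<inter> sphere 0 1"
  have "S = (\<Inter>b\<in>B. {x. x \<bullet> b = 0})" by (auto simp: S_def)
  then have "closed S" by (auto intro!: closed_INT closed_Collect_eq continuous_intros)
  then have "compact K" unfolding K_def by (simp add: closed_Int_compact)
  moreover have "(1 / norm z) *\<^sub>R z \<in> K"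
    using z by (auto simp: K_def S_def orthogonal_def span_base)
  moreover have "continuous_on K (\<lambda>x. x \<bullet> f x)"
    by (intro continuous_intros linear_continuous_on linear_linear[THEN iffD2] lin)
  ultimately obtain v where v: "v \<in> K" and max: "\<And>x. x \<in> K \<Longrightarrow> x \<bullet> f x \<le> v \<bullet> f v"
    using continuous_attains_sup[of K "\<lambda>x. x \<bullet> f x"] by auto
  define l where "l = v \<bullet> f v"
  have nv: "norm v = 1" and vS: "v \<in> S" using v by (auto simp: K_def)
  have rayleigh: "x \<bullet> f x \<le> l * (x \<bullet> x)" if "x \<in> S" for x
  proof (cases "x = 0")
    case True
    then show ?thesis by (simp add: linear_0[OF lin])
  next
    case False
    then have "(1 / norm x) *\<^sub>R x \<in> K" using that S_lin by (auto simp: K_def)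
    from max[OF this] have "(x \<bullet> f x) / (norm x)\<^sup>2 \<le> l"
      by (simp add: linear_scale[OF lin] l_def power2_eq_square)
    with False show ?thesis by (simp add: field_simps power2_norm_eq_inner[symmetric])
  qed
  \<comment> \<open>First variation: the Rayleigh bound at \<open>v + t *\<^sub>R y\<close>, which
    is an equality at \<open>t = 0\<close>, leaves the linear term \<open>2 * t * a\<close> below a
    quadratic one for every \<open>t\<close>, so \<open>a\<close> vanishes.\<close>
  have perp: "y \<bullet> f v = l * (v \<bullet> y)" if "y \<in> S" for y
  proof -
    define a where "a = y \<bullet> f v - l * (v \<bullet> y)"
    define q where "q = l * (y \<bullet> y) - y \<bullet> f y"
    have vv: "v \<bullet> v = 1" using nv by (simp add: norm_eq_1)
    have ineq: "2 * t * a \<le> t\<^sup>2 * q" for t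
    proof -
      have "(v + t *\<^sub>R y) \<bullet> f (v + t *\<^sub>R y) \<le> l * ((v + t *\<^sub>R y) \<bullet> (v + t *\<^sub>R y))"
        by (rule rayleigh[OF S_lin(1)[OF vS that]])
      then show ?thesis
        using sa[of v y]
        by (simp add: linear_add[OF lin] linear_scale[OF lin] inner_add_left inner_add_right
            a_def q_def l_def[symmetric] vv algebra_simps power2_eq_square inner_commute)
    qed
    have "a = 0"
    proof (rule ccontr)
      assume "a \<noteq> 0"
      \<comment> \<open>At this scale the linear term wins:
        \<open>2 * a - t * \<bar>q\<bar> = t * (\<bar>q\<bar> + 2)\<close>.\<close>
      define t where "t = a / (\<bar>q\<bar> + 1)"
      have "t\<^sup>2 * q \<le> t\<^sup>2 * \<bar>q\<bar>" by (intro mult_left_mono) auto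
      with ineq[of t] have "2 * t * a \<le> t\<^sup>2 * \<bar>q\<bar>" by simp
      then have "t * (2 * a - t * \<bar>q\<bar>) \<le> 0" by (simp add: algebra_simps power2_eq_square)
      moreover have "a = t * (\<bar>q\<bar> + 1)" by (simp add: t_def)
      ultimately have "t\<^sup>2 * (\<bar>q\<bar> + 2) \<le> 0" by (simp add: algebra_simps power2_eq_square)
      moreover have "0 < \<bar>q\<bar> + 2" by simp
      ultimately have "t = 0" by (simp add: mult_le_0_iff)
      with \<open>a \<noteq> 0\<close> show False by (auto simp: t_def)
    qed
    then show ?thesis by (simp add: a_def)
  qed
  \<comment> \<open>The residual \<open>w\<close> lies in \<open>S\<close>, so \<open>perp\<close>
    applied to \<open>w\<close> itself gives \<open>w \<bullet> w = 0\<close>.\<close>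
  define w where "w = f v - l *\<^sub>R v"
  have wS: "w \<in> S" using S_lin(1)[OF f_S[OF vS] vS, of "- l"] by (simp add: w_def)
  have "w \<bullet> w = w \<bullet> f v - l * (v \<bullet> w)"
    by (subst (2) w_def) (simp add: inner_diff_right inner_commute)
  also have "\<dots> = 0" using perp[OF wS] by simp
  finally have "f v = l *\<^sub>R v" by (simp add: w_def)
  with nv vS show thesis by (intro that) (auto simp: S_def)
qed

text \<open>Orthonormal eigenvectors are added one at a time. The family is indexed by
  \<open>Basis\<close> so that coordinates in the eigenbasis can be read off from the standard
  coordinates of another vector.\<close>

theorem selfadjoint_orthonormal_eigenbasis:
  fixes f :: "'a::euclidean_space \<Rightarrow> 'a"
  assumes lin: "linear f" and sa: "\<And>x y. f x \<bullet> y = x \<bullet> f y"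
  obtains e :: "'a \<Rightarrow> 'a" and l where "\<And>b. b \<in> Basis \<Longrightarrow> f (e b) = l b *\<^sub>R e b"
    "\<And>b c. b \<in> Basis \<Longrightarrow> c \<in> Basis \<Longrightarrow> e b \<bullet> e c = (if b = c then 1 else 0)"
proof -
  have "\<exists>B. finite B \<and> card B = k \<and> (\<forall>b\<in>B. norm b = 1 \<and> (\<exists>c. f b = c *\<^sub>R b))
      \<and> pairwise orthogonal B" if "k \<le> DIM('a)" for k
    using that
  proof (induction k)
    case 0
    show ?case by (rule exI[of _ "{}"]) auto
  next
    case (Suc k)
    then obtain B where B: "finite B" "card B = k" "\<forall>b\<in>B. norm b = 1 \<and> (\<exists>c. f b = c *\<^sub>R b)"
      "pairwise orthogonal B" by auto
    have "dim B < DIM('a)" using dim_le_card[of B B] B Suc.prems span_superset[of B] by fastforce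
    then obtain v l where v: "norm v = 1" "f v = l *\<^sub>R v" "\<And>b. b \<in> B \<Longrightarrow> v \<bullet> b = 0"
      using selfadjoint_eigenvector_orthogonal[OF lin sa] B(3) by metis
    have "v \<notin> B" using v(1) v(3)[of v] by auto
    with B v show ?case
      by (intro exI[of _ "insert v B"])
        (auto simp: pairwise_insert orthogonal_def[of v] orthogonal_def[of _ v] inner_commute)
  qed
  then obtain B where B: "finite B" "card B = DIM('a)"
    "\<forall>b\<in>B. norm b = 1 \<and> (\<exists>c. f b = c *\<^sub>R b)" "pairwise orthogonal B" by auto
  then obtain e where e: "bij_betw e (Basis::'a set) B"
    using finite_same_card_bij[of "Basis::'a set" B] by auto
  have "\<forall>b. \<exists>c. b \<in> Basis \<longrightarrow> f (e b) = c *\<^sub>R e b"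
    using B(3) bij_betwE[OF e] by blast
  then obtain l where l: "\<And>b. b \<in> Basis \<Longrightarrow> f (e b) = l b *\<^sub>R e b" by metis
  have "e b \<bullet> e c = (if b = c then 1 else 0)" if bc: "b \<in> Basis" "c \<in> Basis" for b c
  proof (cases "b = c")
    case True
    then show ?thesis using B(3) bij_betwE[OF e] bc by (auto simp: norm_eq_1)
  next
    case False
    then have "e b \<noteq> e c" using bc bij_betw_imp_inj_on[OF e] by (auto dest: inj_onD)
    then show ?thesis using False B(4) bij_betwE[OF e] bc
      by (auto simp: pairwise_def orthogonal_def)
  qed
  with l show thesis by (intro that[of e l]) auto
qed

section \<open>Linear changes of variables\<close>

lemma nn_integral_lborel_shift:
  assumes [measurable]: "F \<in> borel_measurable borel"
  shows "(\<integral>\<^sup>+x. F (c + x) \<partial>lborel) = (\<integral>\<^sup>+x. F x \<partial>lborel)"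
  by (subst (2) lborel_distr_plus[of c, symmetric]) (simp add: nn_integral_distr)

text \<open>The double integral of \<open>f x * F (x + L v)\<close>, with \<open>f\<close> the
  indicator of the unit ball, is evaluated in two ways by translation invariance. The factor
  \<open>k\<close>, the absolute determinant of \<open>L\<close>, may stay unspecified because it
  cancels in the final ratio.\<close>

lemma nn_integral_lborel_linear:
  fixes L :: "'a::euclidean_space \<Rightarrow> 'a"
  assumes lin: "linear L" and inj: "inj L"
  obtains k where "0 < k"
    "\<And>F. F \<in> borel_measurable borel \<Longrightarrow>
      (\<integral>\<^sup>+x. F x \<partial>lborel) = ennreal k * (\<integral>\<^sup>+v. F (L v) \<partial>lborel)"
proof -
  obtain M where M: "linear M" "\<And>x. M (L x) = x" "\<And>x. L (M x) = x"
    using linear_injective_isomorphism[OF lin inj] by auto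
  have contL: "continuous_on UNIV L" and [measurable]: "L \<in> borel_measurable borel"
    by (simp_all add: lin linear_continuous_on linear_linear borel_measurable_continuous_onI)
  define f :: "'a \<Rightarrow> ennreal" where "f = indicator (ball 0 1)"
  have [measurable]: "f \<in> borel_measurable borel" unfolding f_def by (intro borel_measurable_indicator) auto
  have f_even: "f (- x) = f x" for x by (simp add: f_def indicator_def)
  \<comment> \<open>The volume of the preimage of the unit ball. That preimage contains a ball about
    0 and is the bounded image of the unit ball under \<open>M\<close>, so \<open>m\<close> is
    positive and finite and can be divided by.\<close>
  define m where "m = (\<integral>\<^sup>+v. f (L v) \<partial>lborel)"
  have m: "m = emeasure lborel (L -` ball 0 1)"
    unfolding m_def f_def
    by (subst nn_integral_indicator[symmetric])
      (auto intro!: nn_integral_cong measurable_sets_borel[of L borel] simp: indicator_def)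
  have op: "open (L -` ball 0 1)"
    by (rule open_vimage[OF open_ball contL])
  moreover have "0 \<in> L -` ball 0 1" by (simp add: linear_0[OF lin])
  ultimately obtain d where d: "d > 0" "ball 0 d \<subseteq> L -` ball 0 1"
    unfolding open_contains_ball by blast
  have "0 < emeasure lborel (ball (0::'a) d)"
    using content_ball_pos[OF d(1), of "0::'a"]
    by (metis enn2real_0 less_irrefl measure_def not_gr_zero)
  also have "\<dots> \<le> m"
    unfolding m using d(2) by (intro emeasure_mono) (auto intro: borel_open op)
  finally have m_pos: "0 < m" .
  have "L -` ball 0 1 = M ` ball 0 1"
    using M(2,3) by (force simp: image_iff intro!: bexI[of _ "L _"])
  then have "bounded (L -` ball 0 1)"
    using bounded_linear_image[OF bounded_ball, of M] M(1) by (simp add: linear_linear)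
  then have m_fin: "m < \<infinity>" unfolding m by (rule emeasure_bounded_finite)
  define n where "n = emeasure lborel (ball (0::'a) 1)"
  have nf: "(\<integral>\<^sup>+x. f x \<partial>lborel) = n" by (simp add: f_def n_def)
  have n_fin: "n < \<infinity>" unfolding n_def by (rule emeasure_lborel_ball_finite)
  have n_pos: "0 < n"
    using content_ball_pos[of 1 "0::'a"] unfolding n_def
    by (metis enn2real_0 less_irrefl measure_def not_gr_zero zero_less_one)
  define k where "k = enn2real (n / m)"
  have nm: "n / m < top" "0 < n / m"
    using n_fin n_pos m_fin m_pos by (auto simp: ennreal_divide_eq_top_iff ennreal_zero_less_divide less_top[symmetric])
  have kpos: "0 < k" unfolding k_def using nm by (simp add: enn2real_positive_iff)
  have kmn: "ennreal k = n / m" unfolding k_def using nm by simp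
  have "(\<integral>\<^sup>+x. F x \<partial>lborel) = ennreal k * (\<integral>\<^sup>+v. F (L v) \<partial>lborel)"
    if [measurable]: "F \<in> borel_measurable borel" for F
  proof -
    \<comment> \<open>Shifting \<open>v\<close> by \<open>M x\<close> puts \<open>x\<close> into the
      argument of \<open>F\<close>. After Fubini, shifting \<open>x\<close> by \<open>L v\<close>
      moves \<open>v\<close> onto \<open>f\<close> alone, whose integral over \<open>v\<close> is
      \<open>m\<close> because the ball is symmetric.\<close>
    have "n * (\<integral>\<^sup>+v. F (L v) \<partial>lborel) = (\<integral>\<^sup>+x. f x * (\<integral>\<^sup>+v. F (L v) \<partial>lborel) \<partial>lborel)"
      using nf by (simp add: nn_integral_multc)
    also have "\<dots> = (\<integral>\<^sup>+x. (\<integral>\<^sup>+v. f x * F (x + L v) \<partial>lborel) \<partial>lborel)"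
    proof (rule nn_integral_cong)
      fix x :: 'a
      have "(\<integral>\<^sup>+v. F (L v) \<partial>lborel) = (\<integral>\<^sup>+v. F (L (M x + v)) \<partial>lborel)"
        by (subst nn_integral_lborel_shift[of "\<lambda>v. F (L v)" "M x"]) auto
      then show "f x * (\<integral>\<^sup>+v. F (L v) \<partial>lborel) = (\<integral>\<^sup>+v. f x * F (x + L v) \<partial>lborel)"
        by (simp add: nn_integral_cmult linear_add[OF lin] M)
    qed
    also have "\<dots> = (\<integral>\<^sup>+v. (\<integral>\<^sup>+x. f x * F (x + L v) \<partial>lborel) \<partial>lborel)"
      by (rule lborel_pair.Fubini') measurable
    also have "\<dots> = (\<integral>\<^sup>+v. (\<integral>\<^sup>+x. f (x - L v) * F x \<partial>lborel) \<partial>lborel)"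
    proof (rule nn_integral_cong)
      fix v :: 'a
      show "(\<integral>\<^sup>+x. f x * F (x + L v) \<partial>lborel) = (\<integral>\<^sup>+x. f (x - L v) * F x \<partial>lborel)"
        by (subst nn_integral_lborel_shift[of "\<lambda>x. f (x - L v) * F x" "L v", symmetric])
          (auto simp: add.commute)
    qed
    also have "\<dots> = (\<integral>\<^sup>+x. (\<integral>\<^sup>+v. f (x - L v) * F x \<partial>lborel) \<partial>lborel)"
      by (rule lborel_pair.Fubini'[symmetric]) measurable
    also have "\<dots> = (\<integral>\<^sup>+x. m * F x \<partial>lborel)"
    proof (rule nn_integral_cong)
      fix x :: 'a
      have "(\<integral>\<^sup>+v. f (x - L v) \<partial>lborel) = (\<integral>\<^sup>+v. f (x - L (M x + v)) \<partial>lborel)"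
        by (subst nn_integral_lborel_shift[of "\<lambda>v. f (x - L v)" "M x"]) auto
      also have "\<dots> = m" by (simp add: linear_add[OF lin] M f_even m_def)
      finally show "(\<integral>\<^sup>+v. f (x - L v) * F x \<partial>lborel) = m * F x"
        by (simp add: nn_integral_multc)
    qed
    also have "\<dots> = m * (\<integral>\<^sup>+x. F x \<partial>lborel)" by (simp add: nn_integral_cmult)
    finally have "(\<integral>\<^sup>+x. F x \<partial>lborel) = n * (\<integral>\<^sup>+v. F (L v) \<partial>lborel) / m"
      using m_pos m_fin by (simp add: mult.commute[of m] ennreal_mult_divide_eq less_top)
    then show ?thesis by (simp add: kmn divide_ennreal_def mult_ac)
  qed
  with kpos show thesis by (rule that)
qed

section \<open>Gaussian integrals\<close>

lemma nn_integral_gaussian_real: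
  assumes "0 < c"
  shows "(\<integral>\<^sup>+x. ennreal (exp (- c * x\<^sup>2 / 2)) \<partial>lborel) = ennreal (sqrt (2 * pi / c))"
proof -
  have "(1 / sqrt c)\<^sup>2 = 1 / c" using assms by (simp add: power_divide)
  then have "exp (- c * x\<^sup>2 / 2) = sqrt (2 * pi / c) * normal_density 0 (1 / sqrt c) x" for x
    using assms by (simp add: normal_density_def mult.commute)
  moreover have "(\<integral>\<^sup>+x. ennreal (normal_density 0 (1 / sqrt c) x) \<partial>lborel) = 1"
    using assms by (simp add: nn_integral_eq_integral)
  ultimately show ?thesis
    using assms by (simp add: ennreal_mult' nn_integral_cmult)
qed

lemma nn_integral_gaussian_diag:
  fixes c :: "'a::euclidean_space \<Rightarrow> real"
  assumes "\<And>b. b \<in> Basis \<Longrightarrow> 0 < c b"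
  shows "(\<integral>\<^sup>+v. ennreal (exp (- (\<Sum>b\<in>Basis. c b * (v \<bullet> b)\<^sup>2) / 2)) \<partial>lborel)
    = ennreal (\<Prod>b\<in>Basis. sqrt (2 * pi / c b))"
proof -
  have "ennreal (exp (- (\<Sum>b\<in>Basis. c b * (v \<bullet> b)\<^sup>2) / 2))
      = (\<Prod>b\<in>Basis. ennreal (exp (- c b * (v \<bullet> b)\<^sup>2 / 2)))" for v :: 'a
    by (simp add: prod_ennreal exp_sum[symmetric] sum_divide_distrib sum_negf)
  then have "(\<integral>\<^sup>+v. ennreal (exp (- (\<Sum>b\<in>Basis. c b * (v \<bullet> b)\<^sup>2) / 2)) \<partial>lborel)
      = (\<integral>\<^sup>+v. (\<Prod>b\<in>Basis. ennreal (exp (- c b * (v \<bullet> b)\<^sup>2 / 2))) \<partial>lborel)"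
    by (simp only:)
  also have "\<dots> = (\<Prod>b\<in>Basis. (\<integral>\<^sup>+x. ennreal (exp (- c b * x\<^sup>2 / 2)) \<partial>lborel))"
    by (rule nn_integral_lborel_prod[where f = "\<lambda>b x. ennreal (exp (- c b * x\<^sup>2 / 2))"]) auto
  also have "\<dots> = (\<Prod>b\<in>Basis. ennreal (sqrt (2 * pi / c b)))"
    using assms by (intro prod.cong nn_integral_gaussian_real) auto
  also have "\<dots> = ennreal (\<Prod>b\<in>Basis. sqrt (2 * pi / c b))"
    using assms by (intro prod_ennreal) (simp add: less_imp_le)
  finally show ?thesis .
qed

text \<open>Concavity of \<open>\<lambda>t. ln (1 - m * t)\<close>: its graph lies above the chord
  over the unit interval. The exponentiated form is weighted AM-GM for \<open>1 - m\<close> and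
  1.\<close>

lemma mult_ln_one_minus_le:
  fixes m t :: real
  assumes "m < 1" "0 \<le> t" "t \<le> 1"
  shows "t * ln (1 - m) \<le> ln (1 - m * t)"
proof -
  have "(1 - m) powr t * 1 powr (1 - t) \<le> t * (1 - m) + (1 - t) * 1"
    by (rule Youngs_inequality_0) (use assms in auto)
  then have "exp (t * ln (1 - m)) \<le> 1 - m * t"
    using assms by (simp add: powr_def algebra_simps)
  then show ?thesis by (metis exp_gt_zero ln_exp ln_mono less_le_trans)
qed

lemma sqrt_two_pi_div: "0 < c \<Longrightarrow> sqrt (2 * pi / c) = sqrt (2 * pi) * exp (- ln c / 2)"
proof -
  assume c: "0 < c"
  have "exp (ln c / 2) = sqrt c"
    using c ln_sqrt[of c] by (metis exp_ln less_imp_le real_sqrt_gt_zero)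
  then show ?thesis by (simp add: real_sqrt_divide exp_minus inverse_eq_divide)
qed

section \<open>Exponential moments and tails of a diagonal quadratic form\<close>

context
  fixes l :: "'a::euclidean_space \<Rightarrow> real"
  assumes l: "\<And>b. b \<in> Basis \<Longrightarrow> 0 \<le> l b" "\<And>b. b \<in> Basis \<Longrightarrow> l b \<le> 1"
begin

text \<open>The exponent is diagonal with coefficients \<open>1 - m * l b\<close>, positive since
  \<open>m < 1\<close> and \<open>0 \<le> l b \<le> 1\<close>. The determinant is written through
  logarithms to prepare for termwise bounds.\<close>

lemma nn_integral_gaussian_perturbed:
  assumes "m < 1"
  shows "(\<integral>\<^sup>+v. ennreal (exp (- (norm v)\<^sup>2 / 2 + m * (\<Sum>b\<in>Basis. l b * (v \<bullet> b)\<^sup>2) / 2)) \<partial>lborel)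
    = ennreal (sqrt (2 * pi) ^ DIM('a) * exp (- (\<Sum>b\<in>Basis. ln (1 - m * l b)) / 2))"
proof -
  have pos: "0 < 1 - m * l b" if "b \<in> Basis" for b
  proof (cases "m \<le> 0")
    case True
    then have "m * l b \<le> 0" using l that by (simp add: mult_nonpos_nonneg)
    then show ?thesis by simp
  next
    case False
    then have "m * l b \<le> m" using l that by (simp add: mult_left_le)
    then show ?thesis using assms by simp
  qed
  have norm: "(norm v)\<^sup>2 = (\<Sum>b\<in>Basis. (v \<bullet> b)\<^sup>2)" for v :: 'a
    unfolding power2_norm_eq_inner by (subst euclidean_inner) (simp add: power2_eq_square)
  have eq: "- (norm v)\<^sup>2 / 2 + m * (\<Sum>b\<in>Basis. l b * (v \<bullet> b)\<^sup>2) / 2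
      = - (\<Sum>b\<in>Basis. (1 - m * l b) * (v \<bullet> b)\<^sup>2) / 2" for v :: 'a
    by (simp add: norm left_diff_distrib sum_subtractf sum_distrib_left mult.assoc diff_divide_distrib)
  have "(\<Prod>b\<in>Basis. sqrt (2 * pi / (1 - m * l b)))
      = sqrt (2 * pi) ^ DIM('a) * exp (- (\<Sum>b\<in>Basis. ln (1 - m * l b)) / 2)"
    using pos by (simp add: sqrt_two_pi_div prod.distrib exp_sum[symmetric] sum_negf sum_divide_distrib)
  then show ?thesis
    unfolding eq using pos by (subst nn_integral_gaussian_diag) auto
qed

text \<open>Bounding each logarithm by its chord in \<open>l b\<close> leaves only the sum of
  \<open>l\<close>, as for a chi-squared variable with that many degrees of freedom.\<close>

lemma nn_integral_gaussian_perturbed_le: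
  assumes "0 \<le> m" "m < 1"
  shows "(\<integral>\<^sup>+v. ennreal (exp (- (norm v)\<^sup>2 / 2 + m * (\<Sum>b\<in>Basis. l b * (v \<bullet> b)\<^sup>2) / 2)) \<partial>lborel)
    \<le> ennreal (sqrt (2 * pi) ^ DIM('a) * exp (- (\<Sum>b\<in>Basis. l b) * ln (1 - m) / 2))"
proof -
  have "(\<Sum>b\<in>Basis. l b) * ln (1 - m) \<le> (\<Sum>b\<in>Basis. ln (1 - m * l b))"
    unfolding sum_distrib_right by (intro sum_mono mult_ln_one_minus_le) (use l assms in auto)
  then show ?thesis
    by (subst nn_integral_gaussian_perturbed[OF assms(2)]) (auto intro!: ennreal_leI mult_left_mono)
qed

text \<open>Termwise \<open>ln (1 + y) \<le> y\<close>. The result is Jensen's inequality, the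
  Gaussian mean of the form being the sum of \<open>l\<close>; it serves below with
  \<open>m = - 1 / 3\<close>.\<close>

lemma nn_integral_gaussian_perturbed_ge:
  assumes "m \<le> 0"
  shows "ennreal (sqrt (2 * pi) ^ DIM('a) * exp (m * (\<Sum>b\<in>Basis. l b) / 2))
    \<le> (\<integral>\<^sup>+v. ennreal (exp (- (norm v)\<^sup>2 / 2 + m * (\<Sum>b\<in>Basis. l b * (v \<bullet> b)\<^sup>2) / 2)) \<partial>lborel)"
proof -
  have "(\<Sum>b\<in>Basis. ln (1 - m * l b)) \<le> (\<Sum>b\<in>Basis. - m * l b)"
  proof (rule sum_mono)
    fix b :: 'a assume "b \<in> Basis"
    then have "0 \<le> - m * l b" using l assms by (simp add: mult_nonpos_nonneg)
    then show "ln (1 - m * l b) \<le> - m * l b"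
      using ln_add_one_self_le_self[of "- m * l b"] by simp
  qed
  also have "\<dots> = - m * (\<Sum>b\<in>Basis. l b)" by (simp only: sum_distrib_left)
  finally show ?thesis
    using assms
    by (subst nn_integral_gaussian_perturbed) (auto intro!: ennreal_leI mult_left_mono)
qed

text \<open>Chernoff's method; the exponent \<open>m = 1 - s\<^sup>2 / x\<^sup>2\<close> is the optimal one for a chi-squared
  variable with \<open>s\<^sup>2\<close> degrees of freedom.\<close>

lemma gaussian_tail_le:
  assumes s: "s\<^sup>2 = (\<Sum>b\<in>Basis. l b)" "0 < s" "s < x"
  shows "(\<integral>\<^sup>+v. ennreal (exp (- (norm v)\<^sup>2 / 2))
        * indicator {v. x \<le> sqrt (\<Sum>b\<in>Basis. l b * (v \<bullet> b)\<^sup>2)} v \<partial>lborel)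
    \<le> ennreal (sqrt (2 * pi) ^ DIM('a) * exp (- (x - s)\<^sup>2 / 2))"
proof -
  define q where "q v = (\<Sum>b\<in>Basis. l b * (v \<bullet> b)\<^sup>2)" for v :: 'a
  have [measurable]: "q \<in> borel_measurable borel" by (simp add: q_def[abs_def])
  define m where "m = 1 - s\<^sup>2 / x\<^sup>2"
  have sx: "s\<^sup>2 < x\<^sup>2" "0 < x" using s(2,3) by (simp_all add: power_strict_mono)
  then have m: "0 \<le> m" "m < 1" using s(2,3) by (simp_all add: m_def)
  have mx: "m * x\<^sup>2 = x\<^sup>2 - s\<^sup>2" using sx by (simp add: m_def left_diff_distrib)
  \<comment> \<open>Exponential Markov inequality: where \<open>x\<^sup>2 \<le> q v\<close>, the
    factor \<open>exp (m * (q v - x\<^sup>2) / 2)\<close> is at least 1.\<close>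
  have "(\<integral>\<^sup>+v. ennreal (exp (- (norm v)\<^sup>2 / 2)) * indicator {v. x \<le> sqrt (q v)} v \<partial>lborel)
    \<le> (\<integral>\<^sup>+v. ennreal (exp (- m * x\<^sup>2 / 2))
          * ennreal (exp (- (norm v)\<^sup>2 / 2 + m * q v / 2)) \<partial>lborel)"
  proof (rule nn_integral_mono)
    fix v :: 'a
    show "ennreal (exp (- (norm v)\<^sup>2 / 2)) * indicator {v. x \<le> sqrt (q v)} v
      \<le> ennreal (exp (- m * x\<^sup>2 / 2)) * ennreal (exp (- (norm v)\<^sup>2 / 2 + m * q v / 2))"
    proof (cases "x \<le> sqrt (q v)")
      case True
      then have "x\<^sup>2 \<le> (sqrt (q v))\<^sup>2" using sx by (intro power_mono) auto
      also have "\<dots> = q v" using True sx by (metis less_le_trans less_imp_le real_sqrt_gt_0_iff real_sqrt_pow2)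
      finally have "m * x\<^sup>2 \<le> m * q v" using m by (intro mult_left_mono)
      then show ?thesis using True
        by (auto simp: ennreal_mult[symmetric] exp_add[symmetric] intro!: ennreal_leI)
    qed simp
  qed
  also have "\<dots> \<le> ennreal (exp (- m * x\<^sup>2 / 2))
      * ennreal (sqrt (2 * pi) ^ DIM('a) * exp (- s\<^sup>2 * ln (1 - m) / 2))"
    unfolding q_def s(1)
    by (subst nn_integral_cmult, measurable)
      (intro mult_left_mono nn_integral_gaussian_perturbed_le m, simp)
  also have "\<dots> = ennreal (sqrt (2 * pi) ^ DIM('a) * exp (- m * x\<^sup>2 / 2 - s\<^sup>2 * ln (1 - m) / 2))"
    by (simp add: ennreal_mult[symmetric] exp_add[symmetric] exp_diff exp_minus field_simps)
  also have "\<dots> \<le> ennreal (sqrt (2 * pi) ^ DIM('a) * exp (- (x - s)\<^sup>2 / 2))"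
  proof -
    have "ln (1 - m) = - 2 * ln (x / s)"
      using s(2,3) by (simp add: m_def ln_div ln_realpow)
    \<comment> \<open>\<open>ln y \<le> y - 1\<close> at \<open>y = x / s\<close> bounds the
      chi-squared rate \<open>(x\<^sup>2 - s\<^sup>2) / 2 - s\<^sup>2 * ln (x / s)\<close> below by
      \<open>(x - s)\<^sup>2 / 2\<close>.\<close>
    moreover have "s\<^sup>2 * ln (x / s) \<le> s\<^sup>2 * (x / s - 1)"
      using s(2,3) by (intro mult_left_mono ln_le_minus_one) auto
    moreover have "s\<^sup>2 * (x / s - 1) = s * x - s\<^sup>2"
      using s(2) by (simp add: field_simps power2_eq_square)
    ultimately have "- m * x\<^sup>2 / 2 - s\<^sup>2 * ln (1 - m) / 2 \<le> - (x - s)\<^sup>2 / 2"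
      using mx by (simp add: power2_diff algebra_simps)
    then show ?thesis by (intro ennreal_leI mult_left_mono) auto
  qed
  finally show ?thesis unfolding q_def .
qed

end

text \<open>The layer-cake formula, with \<open>exp (t\<^sup>2 / 2 - r * t / 3)\<close> written as the integral of its
  derivative.\<close>

lemma nn_integral_exp_quadratic_tail:
  fixes X :: "'a \<Rightarrow> real"
  assumes "sigma_finite_measure M" and [measurable]: "X \<in> borel_measurable M"
    and C: "0 \<le> C" and r: "0 < r" and a: "a = r / 3 - s" "0 < a"
    and tail: "\<And>x. r \<le> x \<Longrightarrow>
      emeasure M {v \<in> space M. x \<le> X v} \<le> ennreal (C * exp (- (x - s)\<^sup>2 / 2))"
  shows "(\<integral>\<^sup>+v. ennreal (exp ((X v)\<^sup>2 / 2 - r * X v / 3)) * indicator {v. r \<le> X v} v \<partial>M)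
    \<le> ennreal (C * exp (- s\<^sup>2 / 2 - a * r) * (1 + 2 * r / (3 * a) + 1 / a\<^sup>2))"
proof -
  interpret sigma_finite_measure M by fact
  interpret lborel_M: pair_sigma_finite lborel M ..
  define \<phi> where "\<phi> t = t\<^sup>2 / 2 - r * t / 3" for t
  define d where "d t = (t - r / 3) * exp (\<phi> t)" for t
  have [measurable]: "d \<in> borel_measurable borel" "\<phi> \<in> borel_measurable borel"
    by (simp_all add: d_def[abs_def] \<phi>_def[abs_def])
  have deriv: "((\<lambda>t. exp (\<phi> t)) has_real_derivative d t) (at t)" for t
    unfolding \<phi>_def d_def by (auto intro!: derivative_eq_intros simp: field_simps)
  have d_nonneg: "0 \<le> d t" if "r \<le> t" for t using that r by (simp add: d_def)
  have cake: "ennreal (exp (\<phi> y)) * indicator {y. r \<le> y} y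
      = ennreal (exp (\<phi> r)) * indicator {y. r \<le> y} y
        + (\<integral>\<^sup>+t. ennreal (d t) * indicator {r..} t * indicator {t. t \<le> y} t \<partial>lborel)" for y
  proof (cases "r \<le> y")
    case True
    have "(\<integral>\<^sup>+t. ennreal (d t) * indicator {r..} t * indicator {t. t \<le> y} t \<partial>lborel)
        = (\<integral>\<^sup>+t. ennreal (d t) * indicator {r..y} t \<partial>lborel)"
      by (intro nn_integral_cong) (auto simp: indicator_def)
    also have "\<dots> = ennreal (exp (\<phi> y) - exp (\<phi> r))"
      using True deriv d_nonneg by (intro nn_integral_FTC_Icc) auto
    finally have *: "(\<integral>\<^sup>+t. ennreal (d t) * indicator {r..} t * indicator {t. t \<le> y} t \<partial>lborel)
        = ennreal (exp (\<phi> y) - exp (\<phi> r))" .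
    have "0 \<le> (y - r) * (y + r - 2 * r / 3)" using True r by (intro mult_nonneg_nonneg) auto
    also have "\<dots> = 2 * (\<phi> y - \<phi> r)" by (simp add: \<phi>_def field_simps power2_eq_square)
    finally have "\<phi> r \<le> \<phi> y" by simp
    then show ?thesis unfolding * using True by (simp add: ennreal_plus[symmetric] del: ennreal_plus)
  next
    case False
    then have "(\<integral>\<^sup>+t. ennreal (d t) * indicator {r..} t * indicator {t. t \<le> y} t \<partial>lborel)
        = (\<integral>\<^sup>+t. 0 \<partial>(lborel :: real measure))"
      by (intro nn_integral_cong) (auto simp: indicator_def)
    with False show ?thesis by simp
  qed
  define c where "c = C * exp (- s\<^sup>2 / 2)"
  have c: "0 \<le> c" using C by (simp add: c_def)
  \<comment> \<open>The quadratic terms cancel: the Gaussian tail absorbs the growth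
    \<open>exp (t\<^sup>2 / 2)\<close> exactly and leaves exponential decay at rate
    \<open>a\<close>.\<close>
  have expo: "\<phi> t - (t - s)\<^sup>2 / 2 = - s\<^sup>2 / 2 - a * t" for t
    by (simp add: \<phi>_def a(1) power2_diff algebra_simps diff_divide_distrib add_divide_distrib)
  have tail': "ennreal (exp (\<phi> t)) * emeasure M {v \<in> space M. t \<le> X v} \<le> ennreal (c * exp (- a * t))"
    if "r \<le> t" for t
  proof -
    have "ennreal (exp (\<phi> t)) * emeasure M {v \<in> space M. t \<le> X v}
        \<le> ennreal (exp (\<phi> t)) * ennreal (C * exp (- (t - s)\<^sup>2 / 2))"
      by (intro mult_left_mono tail that) simp
    also have "\<dots> = ennreal (C * (exp (\<phi> t) * exp (- (t - s)\<^sup>2 / 2)))"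
      using C by (simp add: ennreal_mult[symmetric] mult.left_commute)
    also have "exp (\<phi> t) * exp (- (t - s)\<^sup>2 / 2) = exp (\<phi> t - (t - s)\<^sup>2 / 2)"
      by (simp add: exp_add[symmetric])
    also have "\<dots> = exp (- s\<^sup>2 / 2) * exp (- a * t)"
      unfolding expo exp_add[symmetric] by simp
    also have "C * (exp (- s\<^sup>2 / 2) * exp (- a * t)) = c * exp (- a * t)"
      by (simp add: c_def)
    finally show ?thesis .
  qed
  \<comment> \<open>The antiderivative of the majorant
    \<open>c * (t - r / 3) * exp (- a * t)\<close> that vanishes at infinity.\<close>
  define F where "F t = - (c * exp (- a * t) * ((t - r / 3) / a + 1 / a\<^sup>2))" for t
  have F_deriv: "(F has_real_derivative c * (t - r / 3) * exp (- a * t)) (at t)" for t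
    unfolding F_def using a(2)
    by (auto intro!: derivative_eq_intros simp: field_simps power2_eq_square)
  have F_lim: "(F \<longlongrightarrow> 0) at_top"
    unfolding F_def using a(2) by real_asymp
  have "(\<integral>\<^sup>+v. ennreal (exp (\<phi> (X v))) * indicator {v. r \<le> X v} v \<partial>M)
    = (\<integral>\<^sup>+v. ennreal (exp (\<phi> r)) * indicator {v \<in> space M. r \<le> X v} v
        + (\<integral>\<^sup>+t. ennreal (d t) * indicator {r..} t * indicator {v \<in> space M. t \<le> X v} v \<partial>lborel) \<partial>M)"
  proof (rule nn_integral_cong)
    fix v assume v: "v \<in> space M"
    show "ennreal (exp (\<phi> (X v))) * indicator {v. r \<le> X v} v
      = ennreal (exp (\<phi> r)) * indicator {v \<in> space M. r \<le> X v} v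
        + (\<integral>\<^sup>+t. ennreal (d t) * indicator {r..} t * indicator {v \<in> space M. t \<le> X v} v \<partial>lborel)"
      using cake[of "X v"] v by (simp add: indicator_def)
  qed
  also have "\<dots> = ennreal (exp (\<phi> r)) * emeasure M {v \<in> space M. r \<le> X v}
        + (\<integral>\<^sup>+v. (\<integral>\<^sup>+t. ennreal (d t) * indicator {r..} t * indicator {v \<in> space M. t \<le> X v} v \<partial>lborel) \<partial>M)"
    by (subst nn_integral_add) (auto simp: nn_integral_cmult)
  also have "(\<integral>\<^sup>+v. (\<integral>\<^sup>+t. ennreal (d t) * indicator {r..} t * indicator {v \<in> space M. t \<le> X v} v \<partial>lborel) \<partial>M)
     = (\<integral>\<^sup>+t. (\<integral>\<^sup>+v. ennreal (d t) * indicator {r..} t * indicator {v \<in> space M. t \<le> X v} v \<partial>M) \<partial>lborel)"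
    by (rule lborel_M.Fubini') measurable
  also have "\<dots> = (\<integral>\<^sup>+t. ennreal (d t) * indicator {r..} t * emeasure M {v \<in> space M. t \<le> X v} \<partial>lborel)"
    by (intro nn_integral_cong) (simp add: nn_integral_cmult)
  also have "\<dots> \<le> (\<integral>\<^sup>+t. ennreal (c * (t - r / 3) * exp (- a * t)) * indicator {r..} t \<partial>lborel)"
  proof (rule nn_integral_mono)
    fix t :: real
    show "ennreal (d t) * indicator {r..} t * emeasure M {v \<in> space M. t \<le> X v}
      \<le> ennreal (c * (t - r / 3) * exp (- a * t)) * indicator {r..} t"
    proof (cases "r \<le> t")
      case True
      have "ennreal (d t) * emeasure M {v \<in> space M. t \<le> X v}
          = ennreal (t - r / 3) * (ennreal (exp (\<phi> t)) * emeasure M {v \<in> space M. t \<le> X v})"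
        using True r by (simp add: d_def ennreal_mult mult.assoc)
      also have "\<dots> \<le> ennreal (t - r / 3) * ennreal (c * exp (- a * t))"
        by (intro mult_left_mono tail' True) simp
      also have "\<dots> = ennreal (c * (t - r / 3) * exp (- a * t))"
        using True r c by (simp add: ennreal_mult[symmetric] mult_ac)
      finally show ?thesis using True by simp
    qed simp
  qed
  also have "\<dots> = ennreal (0 - F r)"
  proof (rule nn_integral_FTC_atLeast[OF _ F_deriv _ F_lim])
    show "0 \<le> c * (t - r / 3) * exp (- a * t)" if "r \<le> t" for t
      using c that r by (intro mult_nonneg_nonneg) auto
  qed auto
  \<comment> \<open>The boundary term at \<open>r\<close> contributes the 1 in the final factor, and
    \<open>- F r\<close> the other two summands.\<close>
  also have "ennreal (exp (\<phi> r)) * emeasure M {v \<in> space M. r \<le> X v} + ennreal (0 - F r)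
      \<le> ennreal (c * exp (- a * r)) + ennreal (0 - F r)"
    by (intro add_right_mono tail') simp
  also have "\<dots> = ennreal (c * exp (- a * r) + (0 - F r))"
    using c a r by (intro ennreal_plus[symmetric]) (auto simp: F_def)
  also have "c * exp (- a * r) + (0 - F r) = C * exp (- s\<^sup>2 / 2 - a * r) * (1 + 2 * r / (3 * a) + 1 / a\<^sup>2)"
  proof -
    have "(r - r / 3) / a = 2 * r / (3 * a)" by (simp add: field_simps)
    moreover have "c * exp (- a * r) = C * exp (- s\<^sup>2 / 2 - a * r)"
      by (simp add: c_def mult.assoc exp_add[symmetric])
    ultimately show ?thesis by (simp add: F_def distrib_left)
  qed
  finally show ?thesis unfolding \<phi>_def by (simp add: add_left_mono)
qed

text \<open>At \<open>a = s = 1\<close> the inequality still holds with \<open>0.22\<close> in place of \<open>1 / 3\<close>, which leaves room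
  for crude estimates.\<close>

lemma tail_constant_le:
  fixes a s :: real
  assumes a: "1 \<le> a" and s: "1 \<le> s" and r: "r = 3 * a + 3 * s"
  shows "exp (- s\<^sup>2 / 2 - a * r) * (1 + 2 * r / (3 * a) + 1 / a\<^sup>2)
    \<le> 1 / 3 * exp (- 3 * a\<^sup>2) * (exp (- s\<^sup>2 / 6) - exp (- (r - s)\<^sup>2 / 2))"
proof -
  have s2: "1 \<le> s\<^sup>2" and as: "1 \<le> a\<^sup>2" "s \<le> a * s"
    using a s by (auto simp: one_le_power)
  have e3: "19 \<le> exp (3::real)"
  proof -
    have "(27 / 10) ^ 3 \<le> exp (1::real) ^ 3"
      using e_approx_32 by (intro power_mono) (auto simp: abs_if split: if_splits)
    also have "\<dots> = exp 3" by (simp add: exp_of_nat_mult[symmetric])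
    finally show ?thesis by (simp add: power3_eq_cube)
  qed
  have "1 + 2 * r / (3 * a) + 1 / a\<^sup>2 = 3 + 2 * (s / a) + 1 / a\<^sup>2"
    using a by (simp add: r field_simps)
  also have "\<dots> \<le> 4 + 2 * s"
  proof -
    have "s / a \<le> s" "1 / a\<^sup>2 \<le> 1" using a s as by (simp_all add: divide_le_eq mult_le_cancel_left1)
    then show ?thesis by simp
  qed
  finally have poly: "1 + 2 * r / (3 * a) + 1 / a\<^sup>2 \<le> 4 + 2 * s" .
  \<comment> \<open>The linear factor is absorbed into an exponential; both sides agree at
    \<open>s = 1\<close>, and the right side has the form needed for
    \<open>1 + y \<le> exp y\<close>.\<close>
  have "4 + 2 * s \<le> 6 * (1 + 3 * (s - 1))" using s by simp
  also have "\<dots> \<le> 6 * exp (3 * (s - 1))" by (intro mult_left_mono exp_ge_add_one_self) auto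
  also have "\<dots> = 6 / exp 3 * exp (3 * s)" by (simp add: right_diff_distrib exp_diff)
  also have "\<dots> \<le> 6 / 19 * exp (3 * s)" using e3 by (intro mult_right_mono divide_left_mono) auto
  finally have lin: "exp (- 3 * s) * (4 + 2 * s) \<le> 6 / 19"
    by (simp add: exp_minus field_simps)
  have "exp (- s\<^sup>2 / 2 - a * r) * (1 + 2 * r / (3 * a) + 1 / a\<^sup>2)
      \<le> exp (- s\<^sup>2 / 2 - a * r) * (4 + 2 * s)"
    by (intro mult_left_mono poly) auto
  also have "\<dots> = exp (- 3 * a\<^sup>2) * exp (- s\<^sup>2 / 6) * exp (- s\<^sup>2 / 3 - 3 * (a * s)) * (4 + 2 * s)"
  proof -
    \<comment> \<open>Since \<open>a * r = 3 * a\<^sup>2 + 3 * (a * s)\<close>, the two exponentials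
      of the target split off. The remaining factor is then bounded using
      \<open>1 \<le> s\<^sup>2\<close> and \<open>s \<le> a * s\<close>.\<close>
    have "- s\<^sup>2 / 2 - a * r = - 3 * a\<^sup>2 + - s\<^sup>2 / 6 + (- s\<^sup>2 / 3 - 3 * (a * s))"
      by (simp add: r algebra_simps power2_eq_square)
    then show ?thesis by (simp only: exp_add)
  qed
  also have "\<dots> \<le> exp (- 3 * a\<^sup>2) * exp (- s\<^sup>2 / 6) * (exp (- 1 / 3) * exp (- 3 * s)) * (4 + 2 * s)"
  proof (intro mult_right_mono mult_left_mono)
    show "exp (- s\<^sup>2 / 3 - 3 * (a * s)) \<le> exp (- 1 / 3) * exp (- 3 * s)"
      unfolding exp_add[symmetric] using s2 as(2) by simp
  qed (use s in auto)
  also have "\<dots> = exp (- 3 * a\<^sup>2) * exp (- s\<^sup>2 / 6) * exp (- 1 / 3) * (exp (- 3 * s) * (4 + 2 * s))"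
    by (simp only: mult.assoc)
  also have "\<dots> \<le> exp (- 3 * a\<^sup>2) * exp (- s\<^sup>2 / 6) * (3 / 4) * (6 / 19)"
  proof (intro mult_mono mult_nonneg_nonneg order_refl lin)
    have "4 / 3 \<le> exp (1 / 3 :: real)" using exp_ge_add_one_self[of "1 / 3 :: real"] by simp
    then show "exp (- 1 / 3) \<le> (3 / 4 :: real)" by (simp add: exp_minus field_simps)
  qed (use s in auto)
  \<comment> \<open>\<open>6 / 19\<close> is below \<open>1 / 3\<close>. The factor
    \<open>3 / 4\<close> is kept to pay for the tail subtracted from the inside mass.\<close>
  also have "\<dots> \<le> 1 / 3 * exp (- 3 * a\<^sup>2) * (exp (- s\<^sup>2 / 6) * (3 / 4))"
    by simp
  also have "\<dots> \<le> 1 / 3 * exp (- 3 * a\<^sup>2) * (exp (- s\<^sup>2 / 6) - exp (- (r - s)\<^sup>2 / 2))"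
  proof (intro mult_left_mono)
    have rs: "r - s = 3 * a + 2 * s" by (simp add: r)
    have "(r - s)\<^sup>2 = 9 * a\<^sup>2 + 12 * (a * s) + 4 * s\<^sup>2"
      unfolding rs by (simp add: power2_eq_square algebra_simps)
    then have "- (r - s)\<^sup>2 / 2 \<le> - s\<^sup>2 / 6 + (- 3)" using as s s2 by linarith
    then have "exp (- (r - s)\<^sup>2 / 2) \<le> exp (- s\<^sup>2 / 6 + (- 3))" by simp
    also have "\<dots> = exp (- s\<^sup>2 / 6) * exp (- 3)" by (rule exp_add)
    also have "\<dots> \<le> exp (- s\<^sup>2 / 6) * (1 / 4)"
      using e3 by (intro mult_left_mono) (auto simp: exp_minus field_simps)
    finally show "exp (- s\<^sup>2 / 6) * (3 / 4) \<le> exp (- s\<^sup>2 / 6) - exp (- (r - s)\<^sup>2 / 2)"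
      by simp
  qed simp
  finally show ?thesis .
qed

text \<open>The two integrals are the Gaussian bounds for the masses outside and inside the local
  set. Both estimates carry the same constant \<open>Z\<close>, so \<open>tail_constant_le\<close>
  settles their ratio.\<close>

proposition gaussian_tail_ratio:
  fixes l :: "'a::euclidean_space \<Rightarrow> real"
  assumes l: "\<And>b. b \<in> Basis \<Longrightarrow> 0 \<le> l b" "\<And>b. b \<in> Basis \<Longrightarrow> l b \<le> 1"
    and s: "s\<^sup>2 = (\<Sum>b\<in>Basis. l b)" "1 \<le> s" and r: "3 + 3 * s \<le> r"
  defines "X \<equiv> \<lambda>v. sqrt (\<Sum>b\<in>Basis. l b * (v \<bullet> b)\<^sup>2)"
  shows "(\<integral>\<^sup>+v. ennreal (exp (- (norm v)\<^sup>2 / 2 + (X v)\<^sup>2 / 2 - r * X v / 3)) * indicator {v. r \<le> X v} v \<partial>lborel)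
    \<le> ennreal (1 / 3 * exp (- (r - 3 * s)\<^sup>2 / 3))
       * (\<integral>\<^sup>+v. ennreal (exp (- (norm v)\<^sup>2 / 2 - (X v)\<^sup>2 / 6)) * indicator {v. X v \<le> r} v \<partial>lborel)"
    (is "?N \<le> _ * ?P")
proof -
  \<comment> \<open>The excess of \<open>r\<close>: its lower bound becomes
    \<open>1 \<le> a\<close>, and \<open>(r - 3 * s)\<^sup>2 / 3 = 3 * a\<^sup>2\<close>.\<close>
  define a where "a = r / 3 - s"
  have a: "1 \<le> a" "r = 3 * a + 3 * s" using r by (auto simp: a_def)
  define Z where "Z = sqrt (2 * pi) ^ DIM('a)"
  have Z: "0 < Z" by (simp add: Z_def)
  have X2: "(X v)\<^sup>2 = (\<Sum>b\<in>Basis. l b * (v \<bullet> b)\<^sup>2)" for v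
    unfolding X_def using l by (intro real_sqrt_pow2 sum_nonneg mult_nonneg_nonneg) auto
  have [measurable]: "X \<in> borel_measurable borel" unfolding X_def by measurable
  define M where "M = density lborel (\<lambda>v::'a. ennreal (exp (- (norm v)\<^sup>2 / 2)))"
  have [measurable_cong]: "sets M = sets borel" by (simp add: M_def)
  have tail: "(\<integral>\<^sup>+v. ennreal (exp (- (norm v)\<^sup>2 / 2)) * indicator {v. x \<le> X v} v \<partial>lborel)
      \<le> ennreal (Z * exp (- (x - s)\<^sup>2 / 2))" if "r \<le> x" for x
    unfolding X_def Z_def using that s a by (intro gaussian_tail_le l) auto
  have "emeasure M UNIV \<noteq> \<infinity>"
    using nn_integral_gaussian_perturbed[of l 0, OF l] by (simp add: M_def emeasure_density)
  then have "finite_measure M" by (intro finite_measureI) (simp add: M_def)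
  then have sf: "sigma_finite_measure M" by (rule finite_measure.axioms(1))
  have "?N = (\<integral>\<^sup>+v. ennreal (exp ((X v)\<^sup>2 / 2 - r * X v / 3)) * indicator {v. r \<le> X v} v \<partial>M)"
    unfolding M_def
  proof (subst nn_integral_density, measurable, rule nn_integral_cong)
    fix v :: 'a
    have "exp (- (norm v)\<^sup>2 / 2 + (X v)\<^sup>2 / 2 - r * X v / 3)
        = exp (- (norm v)\<^sup>2 / 2) * exp ((X v)\<^sup>2 / 2 - r * X v / 3)"
      unfolding exp_add[symmetric] by simp
    then show "ennreal (exp (- (norm v)\<^sup>2 / 2 + (X v)\<^sup>2 / 2 - r * X v / 3)) * indicator {v. r \<le> X v} v
      = ennreal (exp (- (norm v)\<^sup>2 / 2)) *
        (ennreal (exp ((X v)\<^sup>2 / 2 - r * X v / 3)) * indicator {v. r \<le> X v} v)"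
      by (simp add: ennreal_mult mult.assoc)
  qed
  also have "\<dots> \<le> ennreal (Z * exp (- s\<^sup>2 / 2 - a * r) * (1 + 2 * r / (3 * a) + 1 / a\<^sup>2))"
  proof (rule nn_integral_exp_quadratic_tail[OF sf _ _ _ a_def])
    show "emeasure M {v \<in> space M. x \<le> X v} \<le> ennreal (Z * exp (- (x - s)\<^sup>2 / 2))" if "r \<le> x" for x
      using tail[OF that] by (simp add: M_def emeasure_density)
  qed (use Z a s in auto)
  also have "\<dots> \<le> ennreal (1 / 3 * exp (- (r - 3 * s)\<^sup>2 / 3)
        * (Z * (exp (- s\<^sup>2 / 6) - exp (- (r - s)\<^sup>2 / 2))))"
  proof (rule ennreal_leI)
    have "(r - 3 * s)\<^sup>2 / 3 = 3 * a\<^sup>2" by (simp add: a(2) power_mult_distrib)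
    then show "Z * exp (- s\<^sup>2 / 2 - a * r) * (1 + 2 * r / (3 * a) + 1 / a\<^sup>2)
      \<le> 1 / 3 * exp (- (r - 3 * s)\<^sup>2 / 3) * (Z * (exp (- s\<^sup>2 / 6) - exp (- (r - s)\<^sup>2 / 2)))"
      using mult_left_mono[OF tail_constant_le[OF a(1) s(2) a(2)], of Z] Z by (simp add: mult_ac)
  qed
  also have "\<dots> = ennreal (1 / 3 * exp (- (r - 3 * s)\<^sup>2 / 3))
        * ennreal (Z * exp (- s\<^sup>2 / 6) - Z * exp (- (r - s)\<^sup>2 / 2))"
    by (subst ennreal_mult') (auto simp: right_diff_distrib)
  also have "\<dots> \<le> ennreal (1 / 3 * exp (- (r - 3 * s)\<^sup>2 / 3)) * ?P"
  proof (rule mult_left_mono)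
    have "ennreal (Z * exp (- s\<^sup>2 / 6))
        \<le> (\<integral>\<^sup>+v. ennreal (exp (- (norm v)\<^sup>2 / 2 - (X v)\<^sup>2 / 6)) \<partial>lborel)"
      using nn_integral_gaussian_perturbed_ge[of l "- 1 / 3", OF l] by (simp add: Z_def s(1) X2)
    \<comment> \<open>Beyond \<open>r\<close> the factor \<open>exp (- (X v)\<^sup>2 / 6)\<close> is
      at most 1, so the Gaussian tail bounds what is lost by restricting to
      \<open>X v \<le> r\<close>.\<close>
    also have "\<dots> \<le> (\<integral>\<^sup>+v. ennreal (exp (- (norm v)\<^sup>2 / 2 - (X v)\<^sup>2 / 6)) * indicator {v. X v \<le> r} v
        + ennreal (exp (- (norm v)\<^sup>2 / 2)) * indicator {v. r \<le> X v} v \<partial>lborel)"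
      by (rule nn_integral_mono) (auto simp: indicator_def intro!: ennreal_leI)
    also have "\<dots> = ?P + (\<integral>\<^sup>+v. ennreal (exp (- (norm v)\<^sup>2 / 2)) * indicator {v. r \<le> X v} v \<partial>lborel)"
      by (rule nn_integral_add) measurable
    also have "\<dots> \<le> ?P + ennreal (Z * exp (- (r - s)\<^sup>2 / 2))"
      by (intro add_left_mono tail) simp
    finally have "ennreal (Z * exp (- s\<^sup>2 / 6)) \<le> ?P + ennreal (Z * exp (- (r - s)\<^sup>2 / 2))" .
    then show "ennreal (Z * exp (- s\<^sup>2 / 6) - Z * exp (- (r - s)\<^sup>2 / 2)) \<le> ?P"
      using Z by (subst ennreal_minus[symmetric]) (auto simp: ennreal_minus_le_iff add.commute)
  qed simp
  finally show ?thesis .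
qed

section \<open>Simultaneous diagonalisation\<close>

lemma sym_pos_def_sym: "sym_pos_def A \<Longrightarrow> (A *v x) \<bullet> y = x \<bullet> (A *v y)"
  unfolding sym_pos_def_def by (metis dot_lmul_matrix transpose_matrix_vector vector_transpose_matrix)

lemma sym_pos_def_nonzero: "sym_pos_def A \<Longrightarrow> x \<noteq> 0 \<Longrightarrow> A *v x \<noteq> 0"
  unfolding sym_pos_def_def by (metis inner_zero_right less_irrefl)

lemma sym_pos_def_inv:
  fixes A :: "real^'n^'n"
  assumes "sym_pos_def A"
  shows "A ** matrix_inv A = mat 1" "matrix_inv A ** A = mat 1"
    "(matrix_inv A *v x) \<bullet> y = x \<bullet> (matrix_inv A *v y)"
proof -
  have "invertible A"
    using sym_pos_def_nonzero[OF assms]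
    by (metis invertible_left_inverse matrix_left_invertible_ker)
  then have "\<exists>B. A ** B = mat 1 \<and> B ** A = mat 1" by (simp add: invertible_def)
  then have "A ** matrix_inv A = mat 1 \<and> matrix_inv A ** A = mat 1"
    unfolding matrix_inv_def by (rule someI_ex)
  then show inv: "A ** matrix_inv A = mat 1" "matrix_inv A ** A = mat 1" by auto
  have "(matrix_inv A *v x) \<bullet> y = (matrix_inv A *v x) \<bullet> (A *v (matrix_inv A *v y))"
    by (simp add: matrix_vector_mul_assoc inv)
  also have "\<dots> = x \<bullet> (matrix_inv A *v y)"
    unfolding sym_pos_def_sym[OF assms, symmetric] by (simp add: matrix_vector_mul_assoc inv)
  finally show "(matrix_inv A *v x) \<bullet> y = x \<bullet> (matrix_inv A *v y)" .
qed

text \<open>Both sides are the squared Hilbert-Schmidt norm, computed column by column.\<close>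

lemma trace_gram:
  fixes A :: "real^'n^'n"
  shows "trace (transpose A ** A) = (\<Sum>b\<in>Basis. (norm (A *v b))\<^sup>2)"
proof -
  have basis: "(Basis :: (real^'n) set) = range (\<lambda>i::'n. axis i (1::real))" by (auto simp: Basis_vec_def)
  have inj: "inj (\<lambda>i::'n. axis i (1::real))" by (auto simp: inj_on_def axis_eq_axis)
  have "(\<Sum>b\<in>Basis. (norm (A *v b))\<^sup>2) = (\<Sum>i\<in>UNIV. (norm (A *v axis i 1))\<^sup>2)"
    unfolding basis by (simp add: sum.reindex[OF inj])
  also have "\<dots> = (\<Sum>i\<in>UNIV. \<Sum>k\<in>UNIV. A $ k $ i * A $ k $ i)"
    unfolding power2_norm_eq_inner matrix_vector_mult_basis by (simp add: inner_vec_def column_def)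
  also have "\<dots> = trace (transpose A ** A)"
    by (simp add: trace_def matrix_matrix_mult_def transpose_def)
  finally show ?thesis by simp
qed

text \<open>By Parseval in either basis, each side is the double sum of
  \<open>(S (e b) \<bullet> c)\<^sup>2\<close>: the Hilbert-Schmidt norm depends neither on the
  basis nor on passing to the adjoint.\<close>

lemma sum_adjoint_orthonormal:
  fixes S T e :: "'a::euclidean_space \<Rightarrow> 'a"
  assumes adj: "\<And>x y. S x \<bullet> y = x \<bullet> T y"
    and e: "\<And>b c. b \<in> Basis \<Longrightarrow> c \<in> Basis \<Longrightarrow> e b \<bullet> e c = (if b = c then 1 else 0)"
  shows "(\<Sum>b\<in>Basis. (norm (S (e b)))\<^sup>2) = (\<Sum>b\<in>Basis. (norm (T b))\<^sup>2)"
proof -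
  have inj: "inj_on e Basis" using e by (metis inj_onI zero_neq_one)
  have orth: "pairwise orthogonal (e ` Basis)"
    using e by (auto simp: pairwise_def orthogonal_def)
  have nz: "0 \<notin> e ` Basis" using e by (metis imageE inner_zero_left zero_neq_one)
  have "dim (e ` Basis) = DIM('a)"
    using pairwise_orthogonal_independent[OF orth nz] inj by (simp add: dim_eq_card_independent card_image)
  then have span: "span (e ` Basis) = UNIV" by (simp add: dim_eq_full)
  have norm2: "(norm x)\<^sup>2 = (\<Sum>c\<in>Basis. (x \<bullet> c)\<^sup>2)" for x :: 'a
    unfolding power2_norm_eq_inner by (subst euclidean_inner) (simp add: power2_eq_square)
  have parseval: "(norm x)\<^sup>2 = (\<Sum>b\<in>Basis. (x \<bullet> e b)\<^sup>2)" for x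
  proof -
    have "(\<Sum>i\<in>e ` Basis. (x \<bullet> i) *\<^sub>R i) = x"
      using orth e span by (intro orthonormal_basis_expand) (auto simp: norm_eq_1)
    then have "x \<bullet> x = x \<bullet> (\<Sum>i\<in>e ` Basis. (x \<bullet> i) *\<^sub>R i)" by simp
    then show ?thesis unfolding power2_norm_eq_inner
      by (simp add: inner_sum_right sum.reindex[OF inj] power2_eq_square)
  qed
  have "(\<Sum>b\<in>Basis. (norm (S (e b)))\<^sup>2) = (\<Sum>b\<in>Basis. \<Sum>c\<in>Basis. (S (e b) \<bullet> c)\<^sup>2)"
    by (intro sum.cong refl) (simp only: norm2)
  also have "\<dots> = (\<Sum>c\<in>Basis. \<Sum>b\<in>Basis. (T c \<bullet> e b)\<^sup>2)"
    by (subst sum.swap) (simp add: adj inner_commute[of _ "T _"])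
  also have "\<dots> = (\<Sum>c\<in>Basis. (norm (T c))\<^sup>2)" by (simp add: parseval)
  finally show ?thesis .
qed

text \<open>From \<open>norm (S x) * norm (S x) = x \<bullet> T (S x) \<le> K * norm x * norm (S
  x)\<close> one factor cancels.\<close>

lemma norm_adjoint_le:
  fixes S T :: "'a::real_inner \<Rightarrow> 'a"
  assumes adj: "\<And>x y. S x \<bullet> y = x \<bullet> T y" and T: "\<And>y. norm (T y) \<le> K * norm y"
  shows "norm (S x) \<le> K * norm x"
proof (cases "S x = 0")
  case True
  then show ?thesis using T[of x] norm_ge_zero[of "T x"] by (simp del: norm_ge_zero)
next
  case False
  have "norm (S x) * norm (S x) = x \<bullet> T (S x)"
    using adj[of x "S x"] by (simp add: power2_norm_eq_inner[symmetric] power2_eq_square)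
  also have "\<dots> \<le> norm x * norm (T (S x))" by (rule norm_cauchy_schwarz)
  also have "\<dots> \<le> norm x * (K * norm (S x))" by (intro mult_left_mono T) simp
  finally have "norm (S x) * norm (S x) \<le> (K * norm x) * norm (S x)" by (simp only: mult_ac)
  then show ?thesis using False by simp
qed

text \<open>\<open>L\<close> is the inverse \<open>Gi\<close> of \<open>G\<close> after an
  orthogonal map \<open>P\<close> onto an eigenbasis of \<open>Gi ** D ** D ** Gi\<close>, which is
  \<open>T\<close> after \<open>S\<close>. The operator norm 1 bounds the eigenvalues
  \<open>l\<close>, and the trace in \<open>eff_dim\<close> is their sum.\<close>

proposition simultaneous_diagonalization:
  fixes G D :: "real^'n^'n"
  assumes G: "sym_pos_def G" and D: "sym_pos_def D" and alpha: "alpha G D = 1"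
  obtains L :: "real^'n \<Rightarrow> real^'n" and l :: "real^'n \<Rightarrow> real"
  where "linear L" "inj L"
    "\<And>v. norm (G *v L v) = norm v"
    "\<And>v. (norm (D *v L v))\<^sup>2 = (\<Sum>b\<in>Basis. l b * (v \<bullet> b)\<^sup>2)"
    "\<And>b. b \<in> Basis \<Longrightarrow> 0 \<le> l b" "\<And>b. b \<in> Basis \<Longrightarrow> l b \<le> 1"
    "eff_dim G D = (\<Sum>b\<in>Basis. l b)" "1 \<le> eff_dim G D"
proof -
  define Gi where "Gi = matrix_inv G"
  note Gi = sym_pos_def_inv[OF G, folded Gi_def]
  define S where "S x = D *v (Gi *v x)" for x
  define T where "T x = Gi *v (D *v x)" for x
  have adj: "S x \<bullet> y = x \<bullet> T y" for x y
    by (simp add: S_def T_def sym_pos_def_sym[OF D] Gi(3))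
  have adj': "T x \<bullet> y = x \<bullet> S y" for x y by (metis adj inner_commute)
  have lin: "linear S" "linear T"
    using linear_compose[OF matrix_vector_mul_linear matrix_vector_mul_linear, of Gi D]
      linear_compose[OF matrix_vector_mul_linear matrix_vector_mul_linear, of D Gi]
    by (simp_all add: S_def[abs_def] T_def[abs_def] o_def)
  have T_eq: "T = (\<lambda>x. (Gi ** D) *v x)" by (simp add: T_def fun_eq_iff matrix_vector_mul_assoc)
  have onT: "onorm T = 1" using alpha by (simp add: alpha_def op_norm_def T_eq Gi_def)
  have blT: "bounded_linear T" using lin by (simp add: linear_linear)
  have T1: "norm (T x) \<le> 1 * norm x" for x using onorm[OF blT, of x] by (simp add: onT)
  have S1: "norm (S x) \<le> 1 * norm x" for x by (rule norm_adjoint_le[OF adj T1])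
  have TS: "linear (\<lambda>x. T (S x))" using linear_compose[OF lin] by (simp add: o_def)
  obtain e :: "real^'n \<Rightarrow> real^'n" and l where
    el: "\<And>b. b \<in> Basis \<Longrightarrow> T (S (e b)) = l b *\<^sub>R e b" and
    e: "\<And>b c. b \<in> Basis \<Longrightarrow> c \<in> Basis \<Longrightarrow> e b \<bullet> e c = (if b = c then 1 else 0)"
    using selfadjoint_orthonormal_eigenbasis[OF TS] adj adj' by metis
  have ne: "norm (e b) = 1" if "b \<in> Basis" for b using e[OF that that] by (simp add: norm_eq_1)
  have lb: "l b = (norm (S (e b)))\<^sup>2" if "b \<in> Basis" for b
    using el[OF that] e[OF that that] by (simp add: power2_norm_eq_inner adj)
  have l01: "0 \<le> l b" "l b \<le> 1" if "b \<in> Basis" for b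
    using lb[OF that] S1[of "e b"] ne[OF that] by (auto simp: power_le_one)
  define P where "P v = (\<Sum>b\<in>Basis. (v \<bullet> b) *\<^sub>R e b)" for v
  have linP: "linear P" unfolding P_def
    by (intro linearI) (simp_all add: inner_add_left scaleR_add_left sum.distrib scaleR_sum_right)
  have inner_P: "P v \<bullet> e b = v \<bullet> b" if "b \<in> Basis" for v b
    using that by (simp add: P_def inner_sum_left e if_distrib cong: if_cong)
  have norm2: "(norm v)\<^sup>2 = (\<Sum>b\<in>Basis. (v \<bullet> b)\<^sup>2)" for v :: "real^'n"
    unfolding power2_norm_eq_inner by (subst euclidean_inner) (simp add: power2_eq_square)
  have "(norm (P v))\<^sup>2 = (norm v)\<^sup>2" for v
  proof -
    have "P v \<bullet> P v = (\<Sum>b\<in>Basis. (v \<bullet> b) * (P v \<bullet> e b))"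
      by (subst (2) P_def) (simp add: inner_sum_right)
    then show ?thesis
      unfolding power2_norm_eq_inner[of "P v"] norm2[of v] by (simp add: inner_P power2_eq_square)
  qed
  then have nP: "norm (P v) = norm v" for v by simp
  have SP: "(norm (S (P v)))\<^sup>2 = (\<Sum>b\<in>Basis. l b * (v \<bullet> b)\<^sup>2)" for v
  proof -
    have "T (S (P v)) = (\<Sum>b\<in>Basis. (v \<bullet> b) *\<^sub>R T (S (e b)))"
      unfolding P_def by (simp add: linear_sum[OF TS] linear_scale[OF TS])
    also have "\<dots> = (\<Sum>b\<in>Basis. ((v \<bullet> b) * l b) *\<^sub>R e b)" by (simp add: el)
    finally have "P v \<bullet> T (S (P v)) = (\<Sum>b\<in>Basis. ((v \<bullet> b) * l b) * (P v \<bullet> e b))"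
      by (simp add: inner_sum_right)
    then show ?thesis
      unfolding power2_norm_eq_inner adj by (simp add: inner_P power2_eq_square mult_ac)
  qed
  define L where "L v = Gi *v P v" for v
  have GL: "G *v L v = P v" for v by (simp add: L_def matrix_vector_mul_assoc Gi)
  have DL: "D *v L v = S (P v)" for v by (simp add: L_def S_def)
  have linL: "linear L"
    unfolding L_def[abs_def] using linear_compose[OF linP, of "(*v) Gi"] by (simp add: o_def)
  have "v = 0" if "L v = 0" for v using GL[of v] nP[of v] that by simp
  then have injL: "inj L" using linear_injective_0[OF linL] by blast
  \<comment> \<open>The denominator is 1. Cyclicity gives the trace the Gram form of
    \<open>T\<close>; passing to the adjoint \<open>S\<close> and the basis \<open>e\<close> turns
    it into the sum of \<open>l\<close>.\<close>
  have "eff_dim G D = trace ((Gi ** (Gi ** D)) ** D)"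
    using alpha by (simp add: eff_dim_def alpha_def Gi_def matrix_mul_assoc)
  also have "\<dots> = trace (D ** (Gi ** (Gi ** D)))" by (rule trace_mul_sym)
  also have "D ** (Gi ** (Gi ** D)) = transpose (Gi ** D) ** (Gi ** D)"
  proof -
    have "transpose Gi ** G = mat 1"
      using arg_cong[OF Gi(1), of transpose] G
      by (simp add: matrix_transpose_mul sym_pos_def_def transpose_mat)
    then have "transpose Gi = Gi"
      by (metis Gi(1) matrix_mul_assoc matrix_mul_lid matrix_mul_rid)
    moreover have "transpose D = D" using D by (simp add: sym_pos_def_def)
    ultimately show ?thesis by (simp add: matrix_transpose_mul matrix_mul_assoc)
  qed
  also have "trace \<dots> = (\<Sum>b\<in>Basis. (norm (T b))\<^sup>2)" by (simp add: trace_gram T_eq)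
  also have "\<dots> = (\<Sum>b\<in>Basis. (norm (S (e b)))\<^sup>2)"
    by (rule sum_adjoint_orthonormal[OF adj e, symmetric])
  also have "\<dots> = (\<Sum>b\<in>Basis. l b)" by (simp add: lb)
  finally have eff: "eff_dim G D = (\<Sum>b\<in>Basis. l b)" .
  \<comment> \<open>The operator norm is at most the Hilbert-Schmidt norm: \<open>S\<close> is
    bounded by \<open>sqrt p\<close>, hence so is its adjoint \<open>T\<close>, which has norm
    1.\<close>
  have "1 \<le> (\<Sum>b\<in>Basis. l b)"
  proof -
    define p where "p = (\<Sum>b\<in>Basis. l b)"
    have p: "0 \<le> p" unfolding p_def using l01 by (intro sum_nonneg) auto
    have "norm (T y) \<le> sqrt p * norm y" for y
    proof (rule norm_adjoint_le[OF adj'])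
      fix x
      have "(norm (S x))\<^sup>2 \<le> p * (norm x)\<^sup>2"
      proof -
        have "inj P" using nP by (metis linP linear_injective_0 norm_eq_zero)
        then obtain v where v: "x = P v"
          using linear_injective_imp_surjective[OF linP] by (metis surjD)
        have "(\<Sum>b\<in>Basis. l b * (v \<bullet> b)\<^sup>2) \<le> (\<Sum>b\<in>Basis. l b * (norm v)\<^sup>2)"
          using l01 by (intro sum_mono mult_left_mono) (auto intro!: power2_le_iff_abs_le[THEN iffD2] Basis_le_norm)
        then show ?thesis unfolding v SP nP p_def by (simp add: sum_distrib_right)
      qed
      then show "norm (S x) \<le> sqrt p * norm x"
        using p by - (rule power2_le_imp_le, simp_all add: power_mult_distrib)
    qed
    then have "onorm T \<le> sqrt p" using p by (intro onorm_bound) auto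
    then show ?thesis unfolding p_def[symmetric] using onT by simp
  qed
  with eff show thesis
    by (intro that[OF linL injL]) (auto simp: GL DL nP SP l01)
qed

section \<open>Convexity along rays and the Gibbs measure\<close>

text \<open>Bridge between the matrix of iterated partial derivatives and the second Frechet
  derivative, by bilinear expansion in the standard basis.\<close>

lemma hessian_quadratic_form:
  fixes f :: "real^'n \<Rightarrow> real"
  assumes f1: "\<And>x. (f has_derivative blinfun_apply (f1 x)) (at x)"
    and f2: "\<And>x. (f1 has_derivative blinfun_apply (f2 x)) (at x)"
  shows "v \<bullet> (hessian f x *v v) = f2 x v v"
proof -
  have "frechet_derivative f (at y) = blinfun_apply (f1 y)" for y
    using frechet_derivative_at[OF f1] by simp
  moreover have "((\<lambda>y. f1 y w) has_derivative (\<lambda>h. f2 x h w)) (at x)" for w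
    by (auto intro!: derivative_eq_intros f2)
  then have "frechet_derivative (\<lambda>y. f1 y w) (at x) = (\<lambda>h. f2 x h w)" for w
    by (rule frechet_derivative_at[symmetric])
  ultimately have H: "hessian f x $ i $ j = f2 x (axis i 1) (axis j 1)" for i j
    by (simp add: hessian_def)
  have v: "v = (\<Sum>i\<in>UNIV. v $ i *\<^sub>R axis i 1)"
    using basis_expansion[of v] by (simp add: scalar_mult_eq_scaleR)
  have "f2 x v v = (\<Sum>i\<in>UNIV. \<Sum>j\<in>UNIV. v $ i * (v $ j * hessian f x $ i $ j))"
    by (subst (1 2) v, simp add: blinfun.sum_left blinfun.sum_right blinfun.scaleR_left
        blinfun.scaleR_right sum_distrib_left, subst sum.swap, simp add: H mult.left_commute)
  then show ?thesis
    by (simp add: inner_vec_def matrix_vector_mult_def sum_distrib_left mult_ac)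
qed

text \<open>The second derivative in \<open>t\<close> is the quadratic form of
  \<open>hessian f (x0 + t *\<^sub>R u) - (hessian f x0 - D ** D)\<close> at \<open>u\<close>,
  nonnegative by the Hessian condition.\<close>

lemma convex_on_line_quadratic_correction:
  fixes f :: "real^'n \<Rightarrow> real"
  assumes f: "thrice_differentiable f" and G: "sym_pos_def G" "G ** G = hessian f x0"
    and D: "sym_pos_def D" and H: "\<And>x. hessian f x0 - D ** D \<preceq> hessian f x"
  shows "convex_on UNIV (\<lambda>t. f (x0 + t *\<^sub>R u) + t\<^sup>2 / 2 * ((norm (D *v u))\<^sup>2 - (norm (G *v u))\<^sup>2))"
proof -
  obtain f1 f2 where f1: "\<And>x. (f has_derivative blinfun_apply (f1 x)) (at x)"
    and f2: "\<And>x. (f1 has_derivative blinfun_apply (f2 x)) (at x)"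
    using f unfolding thrice_differentiable_def by blast
  define c where "c = (norm (D *v u))\<^sup>2 - (norm (G *v u))\<^sup>2"
  define p where "p t = x0 + t *\<^sub>R u" for t :: real
  have p: "(p has_derivative (\<lambda>h. h *\<^sub>R u)) (at t)" for t
    unfolding p_def by (auto intro!: derivative_eq_intros)
  have d1: "((\<lambda>t. f (p t)) has_real_derivative f1 (p t) u) (at t)" for t
    using has_derivative_compose[OF p f1]
    by (simp add: has_field_derivative_def blinfun.scaleR_right mult.commute[of _ "blinfun_apply _ _"])
  have "((\<lambda>t. f1 (p t)) has_derivative (\<lambda>h. f2 (p t) (h *\<^sub>R u))) (at t)" for t
    by (rule has_derivative_compose[OF p f2])
  then have "((\<lambda>t. f1 (p t) u) has_derivative (\<lambda>h. f2 (p t) (h *\<^sub>R u) u)) (at t)" for t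
    by (auto intro!: derivative_eq_intros)
  then have d2: "((\<lambda>t. f1 (p t) u) has_real_derivative f2 (p t) u u) (at t)" for t
    by (simp add: has_field_derivative_def blinfun.scaleR_right blinfun.scaleR_left
        mult.commute[of _ "blinfun_apply _ _"])
  have sq: "u \<bullet> ((A ** A) *v u) = (norm (A *v u))\<^sup>2" if "sym_pos_def A" for A :: "real^'n^'n"
    by (simp add: matrix_vector_mul_assoc[symmetric] sym_pos_def_sym[OF that, symmetric] power2_norm_eq_inner)
  have d3: "0 \<le> f2 (p t) u u + c" for t
  proof -
    have "0 \<le> u \<bullet> ((hessian f (p t) - (hessian f x0 - D ** D)) *v u)"
      using H by (simp add: loewner_le_def)
    then show ?thesis
      by (simp add: matrix_vector_mult_diff_rdistrib inner_diff_right hessian_quadratic_form[OF f1 f2, of u "p t"]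
          sq[OF D] c_def G(2)[symmetric] sq[OF G(1)])
  qed
  have "convex_on UNIV (\<lambda>t. f (p t) + t\<^sup>2 / 2 * c)"
  proof (rule f''_ge0_imp_convex)
    show "((\<lambda>t. f (p t) + t\<^sup>2 / 2 * c) has_real_derivative f1 (p t) u + t * c) (at t)" for t
      by (auto intro!: derivative_eq_intros d1)
    show "((\<lambda>t. f1 (p t) u + t * c) has_real_derivative f2 (p t) u u + c) (at t)" for t
      by (auto intro!: derivative_eq_intros d2)
  qed (use d3 in auto)
  then show ?thesis by (simp add: p_def c_def)
qed

lemma omega_bound:
  assumes D: "sym_pos_def D" and omega: "omega f x0 G U D \<le> ereal c" and x: "x \<in> U"
  shows "\<bar>f x - f x0 - (norm (G *v (x - x0)))\<^sup>2 / 2\<bar> \<le> c * (norm (D *v (x - x0)))\<^sup>2 / 2"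
proof (cases "x = x0")
  case False
  then have pos: "0 < (norm (D *v (x - x0)))\<^sup>2 / 2"
    using sym_pos_def_nonzero[OF D, of "x - x0"] by simp
  have "ereal (\<bar>f x - f x0 - (norm (G *v (x - x0)))\<^sup>2 / 2\<bar> / ((norm (D *v (x - x0)))\<^sup>2 / 2))
      \<le> omega f x0 G U D"
    unfolding omega_def using x False by (intro SUP_upper) auto
  from order_trans[OF this omega]
  have "\<bar>f x - f x0 - (norm (G *v (x - x0)))\<^sup>2 / 2\<bar> / ((norm (D *v (x - x0)))\<^sup>2 / 2) \<le> c"
    by (rule ereal_less_eq(3)[THEN iffD1])
  then show ?thesis using pos by (simp only: pos_divide_le_eq[OF pos] times_divide_eq_right)
qed simp

text \<open>Convexity along the ray through the boundary point \<open>r u / |D u|\<close> of \<open>local_set x0 D r\<close>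
  propagates the local bound outwards.\<close>

lemma outer_lower_bound:
  fixes f :: "real^'n \<Rightarrow> real"
  assumes f: "thrice_differentiable f" and G: "sym_pos_def G" "G ** G = hessian f x0"
    and D: "sym_pos_def D" and H: "\<And>x. hessian f x0 - D ** D \<preceq> hessian f x"
    and omega: "omega f x0 G (local_set x0 D r) D \<le> ereal (1 / 3)"
    and r: "0 < r" "r \<le> norm (D *v u)"
  shows "(norm (G *v u))\<^sup>2 / 2 - (norm (D *v u))\<^sup>2 / 2 + r * norm (D *v u) / 3 \<le> f (x0 + u) - f x0"
proof -
  define \<rho> where "\<rho> = norm (D *v u)"
  define t where "t = r / \<rho>"
  have \<rho>: "0 < \<rho>" "r \<le> \<rho>" using r by (auto simp: \<rho>_def)
  have t: "0 < t" "t \<le> 1" "t * \<rho> = r" using \<rho> r by (auto simp: t_def)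
  define c where "c = \<rho>\<^sup>2 - (norm (G *v u))\<^sup>2"
  define \<psi> where "\<psi> s = f (x0 + s *\<^sub>R u) + s\<^sup>2 / 2 * c" for s :: real
  have "convex_on UNIV \<psi>"
    unfolding \<psi>_def c_def \<rho>_def by (rule convex_on_line_quadratic_correction[OF f G D H])
  from convex_onD[OF this, of t 0 1] have conv: "\<psi> t \<le> (1 - t) * \<psi> 0 + t * \<psi> 1"
    using t by simp
  have nD: "norm (D *v (t *\<^sub>R u)) = r" and nG: "norm (G *v (t *\<^sub>R u)) = t * norm (G *v u)"
    using t by (simp_all add: matrix_vector_mult_scaleR \<rho>_def)
  have "x0 + t *\<^sub>R u \<in> local_set x0 D r" by (simp add: local_set_def nD)
  from omega_bound[OF D omega this]
  \<comment> \<open>At the boundary point the local error is at most \<open>r\<^sup>2 / 6\<close>.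
    The correction in \<open>\<psi>\<close> cancels the \<open>G\<close> term and adds
    \<open>r\<^sup>2 / 2\<close>, leaving an excess of \<open>r\<^sup>2 / 3\<close>.\<close>
  have "f x0 + (t * norm (G *v u))\<^sup>2 / 2 - r\<^sup>2 / 6 \<le> f (x0 + t *\<^sub>R u)"
    unfolding add_diff_cancel_left' nD nG by linarith
  then have "f x0 + r\<^sup>2 / 3 \<le> \<psi> t"
    by (simp add: \<psi>_def c_def t(3)[symmetric] power_mult_distrib algebra_simps)
  with conv have "r\<^sup>2 / 3 \<le> t * (\<psi> 1 - f x0)"
    by (simp add: \<psi>_def algebra_simps)
  \<comment> \<open>Cancelling \<open>t = r / \<rho>\<close> turns the constant
    \<open>r\<^sup>2 / 3\<close> into growth linear in \<open>\<rho>\<close>.\<close>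
  moreover have "r\<^sup>2 / 3 = t * (r * \<rho> / 3)"
    unfolding power2_eq_square by (subst (1) t(3)[symmetric]) simp
  ultimately have "r * \<rho> / 3 \<le> \<psi> 1 - f x0" using t by (simp only: mult_le_cancel_left_pos)
  then show ?thesis by (simp add: \<psi>_def c_def \<rho>_def[symmetric] diff_divide_distrib)
qed

section \<open>The Gibbs measure and the comparison of masses\<close>

lemma thrice_differentiable_borel_measurable:
  fixes f :: "real^'n \<Rightarrow> real"
  assumes "thrice_differentiable f"
  shows "f \<in> borel_measurable borel"
  using assms unfolding thrice_differentiable_def
  by (metis borel_measurable_continuous_onI continuous_at_imp_continuous_on has_derivative_continuous)

lemma measure_gibbs_le:
  assumes [measurable]: "f \<in> borel_measurable borel" "A \<in> sets borel"
    and int: "integrable lborel (\<lambda>x. exp (- f x))" and c: "0 \<le> c"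
    and le: "(\<integral>\<^sup>+x. ennreal (exp (- f x)) * indicator A x \<partial>lborel)
      \<le> ennreal c * (\<integral>\<^sup>+x. ennreal (exp (- f x)) \<partial>lborel)"
  shows "measure (gibbs_measure f) A \<le> c"
proof -
  define Z where "Z = (\<integral>x. exp (- f x) \<partial>lborel)"
  have Z: "0 \<le> Z" "(\<integral>\<^sup>+x. ennreal (exp (- f x)) \<partial>lborel) = ennreal Z"
    using int by (simp_all add: Z_def nn_integral_eq_integral)
  have "emeasure (gibbs_measure f) A
      = (\<integral>\<^sup>+x. ennreal (1 / Z) * (ennreal (exp (- f x)) * indicator A x) \<partial>lborel)"
    unfolding gibbs_measure_def Z_def[symmetric] using Z(1)
    by (subst emeasure_density)
      (auto intro!: nn_integral_cong simp: ennreal_mult[symmetric] mult.assoc[symmetric])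
  also have "\<dots> \<le> ennreal (1 / Z) * (ennreal c * ennreal Z)"
    by (subst nn_integral_cmult) (auto intro!: mult_left_mono le simp: Z(2)[symmetric])
  also have "\<dots> = ennreal (c * (Z / Z))"
    using Z(1) c by (simp add: ennreal_mult[symmetric] mult.commute)
  \<comment> \<open>For \<open>Z = 0\<close> the quotient \<open>Z / Z\<close> is 0 by convention,
    and the bound holds since \<open>0 \<le> c\<close>.\<close>
  also have "\<dots> \<le> ennreal c" using c by (cases "Z = 0") auto
  finally show ?thesis using c by (simp add: measure_def enn2real_leI)
qed

theorem theorem2p3:
  fixes f :: "real^'p \<Rightarrow> real"
    and \<theta>0 :: "real^'p"
    and DG D :: "real^'p^'p"
    and r :: real
  assumes "thrice_differentiable f"
    and "integrable lborel (\<lambda>\<theta>. exp (- f \<theta>))"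
    and "unique_global_minimizer f \<theta>0"
    and "sym_pos_def (hessian f \<theta>0)"
    and "sym_pos_def DG" and "DG ** DG = hessian f \<theta>0"
    and "sym_pos_def D" and "alpha DG D = 1"
    and "\<forall>\<theta>. hessian f \<theta>0 - D ** D \<preceq> hessian f \<theta>"
    and "r \<ge> 3 + 3 * sqrt (eff_dim DG D)"
    and "omega f \<theta>0 DG (local_set \<theta>0 D r) D \<le> ereal (1/3)"
  shows "measure (gibbs_measure f) (- local_set \<theta>0 D r)
           \<le> 1/3 * exp (- ((r - 3 * sqrt (eff_dim DG D))\<^sup>2 / 3))"
proof -
  have [measurable]: "f \<in> borel_measurable borel"
    by (rule thrice_differentiable_borel_measurable) fact
  obtain L :: "real^'p \<Rightarrow> real^'p" and l :: "real^'p \<Rightarrow> real" where L: "linear L" "inj L"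
    and GL: "\<And>v. norm (DG *v L v) = norm v"
    and DL: "\<And>v. (norm (D *v L v))\<^sup>2 = (\<Sum>b\<in>Basis. l b * (v \<bullet> b)\<^sup>2)"
    and l: "\<And>b. b \<in> Basis \<Longrightarrow> 0 \<le> l b" "\<And>b. b \<in> Basis \<Longrightarrow> l b \<le> 1"
    and eff: "eff_dim DG D = (\<Sum>b\<in>Basis. l b)" "1 \<le> eff_dim DG D"
    by (rule simultaneous_diagonalization[OF assms(5,7,8)]) (rule that)
  define s where "s = sqrt (eff_dim DG D)"
  have s: "s\<^sup>2 = (\<Sum>b\<in>Basis. l b)" "1 \<le> s" using eff by (simp_all add: s_def)
  have r: "3 + 3 * s \<le> r" "0 < r" using assms(10) s(2) unfolding s_def[symmetric] by auto
  define U where "U = local_set \<theta>0 D r"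
  have U_iff: "\<theta>0 + u \<in> U \<longleftrightarrow> norm (D *v u) \<le> r" for u by (simp add: U_def local_set_def)
  have "closed U"
    unfolding U_def local_set_def
    by (intro closed_Collect_le continuous_intros continuous_on_compose2[OF matrix_vector_mult_linear_continuous_on[of UNIV]]) auto
  then have [measurable]: "U \<in> sets borel" by simp
  define X where "X v = sqrt (\<Sum>b\<in>Basis. l b * (v \<bullet> b)\<^sup>2)" for v
  have X: "norm (D *v L v) = X v" for v unfolding X_def DL[symmetric] by simp
  have [measurable]: "X \<in> borel_measurable borel" unfolding X_def[abs_def] by measurable
  define c where "c = 1 / 3 * exp (- (r - 3 * s)\<^sup>2 / 3)"
  \<comment> \<open>\<open>E\<close> and the Jacobian factor \<open>k\<close> enter the estimates
    inside and outside alike, so they drop out of the ratio.\<close>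
  define E where "E = ennreal (exp (- f \<theta>0))"
  obtain k where k: "\<And>F. F \<in> borel_measurable borel \<Longrightarrow>
      (\<integral>\<^sup>+x. F x \<partial>lborel) = ennreal k * (\<integral>\<^sup>+v. F (L v) \<partial>lborel)"
    using nn_integral_lborel_linear[OF L] by metis
  have [measurable]: "L \<in> borel_measurable borel"
    by (simp add: L linear_continuous_on linear_linear borel_measurable_continuous_onI)
  \<comment> \<open>The substitution \<theta> = \<open>\<theta>0 + L v\<close>, under which the
    \<open>G\<close>-norm of the displacement becomes \<open>norm v\<close> and its
    \<open>D\<close>-norm becomes \<open>X v\<close>.\<close>
  have subst: "(\<integral>\<^sup>+x. F x \<partial>lborel) = ennreal k * (\<integral>\<^sup>+v. F (\<theta>0 + L v) \<partial>lborel)"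
    if [measurable]: "F \<in> borel_measurable borel" for F
    by (subst nn_integral_lborel_shift[symmetric, of _ \<theta>0]) (auto intro: k[of "\<lambda>x. F (\<theta>0 + x)"])
  define N where "N = (\<integral>\<^sup>+v. ennreal (exp (- (norm v)\<^sup>2 / 2 + (X v)\<^sup>2 / 2 - r * X v / 3))
    * indicator {v. r \<le> X v} v \<partial>lborel)"
  define P where "P = (\<integral>\<^sup>+v. ennreal (exp (- (norm v)\<^sup>2 / 2 - (X v)\<^sup>2 / 6))
    * indicator {v. X v \<le> r} v \<partial>lborel)"
  have NP: "N \<le> ennreal c * P"
    unfolding N_def P_def c_def X_def by (rule gaussian_tail_ratio[OF l s r(1)])
  have "(\<integral>\<^sup>+x. ennreal (exp (- f x)) * indicator (- U) x \<partial>lborel)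
      = ennreal k * (\<integral>\<^sup>+v. ennreal (exp (- f (\<theta>0 + L v))) * indicator (- U) (\<theta>0 + L v) \<partial>lborel)"
    by (rule subst) measurable
  also have "(\<integral>\<^sup>+v. ennreal (exp (- f (\<theta>0 + L v))) * indicator (- U) (\<theta>0 + L v) \<partial>lborel) \<le> E * N"
    unfolding N_def
  proof (subst nn_integral_cmult[symmetric], measurable, rule nn_integral_mono)
    fix v
    show "ennreal (exp (- f (\<theta>0 + L v))) * indicator (- U) (\<theta>0 + L v)
      \<le> E * (ennreal (exp (- (norm v)\<^sup>2 / 2 + (X v)\<^sup>2 / 2 - r * X v / 3)) * indicator {v. r \<le> X v} v)"
    proof (cases "\<theta>0 + L v \<in> U")
      case False
      then have "r \<le> X v" by (simp add: U_iff X)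
      moreover from this have "- f (\<theta>0 + L v)
          \<le> - f \<theta>0 + (- (norm v)\<^sup>2 / 2 + (X v)\<^sup>2 / 2 - r * X v / 3)"
        using outer_lower_bound[OF assms(1,5,6,7) _ assms(11) r(2), of "L v"] assms(9)
        by (simp add: X GL)
      ultimately show ?thesis using False
        by (simp add: E_def ennreal_mult[symmetric] exp_add[symmetric])
    qed simp
  qed
  also have "ennreal k * (E * N) \<le> ennreal k * (E * (ennreal c * P))"
    by (intro mult_left_mono NP) auto
  also have "\<dots> = ennreal c * (ennreal k * (E * P))" by (simp only: mult_ac)
  \<comment> \<open>The normalising integral is bounded below by its part inside \<open>U\<close>,
    where the bound on \<open>omega\<close> controls \<open>f\<close> from above.\<close>
  also have "E * P \<le> (\<integral>\<^sup>+v. ennreal (exp (- f (\<theta>0 + L v))) \<partial>lborel)"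
    unfolding P_def
  proof (subst nn_integral_cmult[symmetric], measurable, rule nn_integral_mono)
    fix v
    show "E * (ennreal (exp (- (norm v)\<^sup>2 / 2 - (X v)\<^sup>2 / 6)) * indicator {v. X v \<le> r} v)
      \<le> ennreal (exp (- f (\<theta>0 + L v)))"
    proof (cases "X v \<le> r")
      case True
      then have "\<theta>0 + L v \<in> local_set \<theta>0 D r" by (simp add: local_set_def X)
      from abs_le_D1[OF omega_bound[OF assms(7,11) this]] have "- f \<theta>0 + (- (norm v)\<^sup>2 / 2 - (X v)\<^sup>2 / 6) \<le> - f (\<theta>0 + L v)"
        by (simp add: X GL)
      with True show ?thesis
        by (simp add: E_def ennreal_mult[symmetric] exp_add[symmetric])
    qed simp
  qed
  also have "ennreal k * (\<integral>\<^sup>+v. ennreal (exp (- f (\<theta>0 + L v))) \<partial>lborel)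
      = (\<integral>\<^sup>+x. ennreal (exp (- f x)) \<partial>lborel)"
    by (rule subst[symmetric]) measurable
  finally have "(\<integral>\<^sup>+x. ennreal (exp (- f x)) * indicator (- U) x \<partial>lborel)
      \<le> ennreal c * (\<integral>\<^sup>+x. ennreal (exp (- f x)) \<partial>lborel)"
    by (simp add: mult_left_mono)
  then have "measure (gibbs_measure f) (- U) \<le> c"
    by (intro measure_gibbs_le assms(2)) (auto simp: c_def)
  then show ?thesis by (simp add: U_def c_def s_def)
qed

end
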